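(* Let $d\ge2$ and $n\ge2$. Among all flat tori $\mathbb{R}^d/T\mathbb{Z}^d$, where $T$ is an invertible linear transformation of $\mathbb{R}^d$, the normalized eigenvalue sum $$\big(\tau_2+\dots+\tau_n\big)\,\frac{1}{\lVert T^{-\dagger}\rVert_{HS}^2}$$ is maximal when $T$ is a scalar multiple of an orthogonal matrix (that is, when the torus is cubical).
   Context: For an invertible linear transformation $T$ of $\mathbb{R}^d$, $T\mathbb{Z}^d$ is a lattice and $\mathbb{R}^d/T\mathbb{Z}^d$ is a flat torus. Its Laplace eigenvalues, repeated according to multiplicity, are denoted $0=\tau_1<\tau_2\le\tau_3\le\cdots$, with eigenfunctions satisfying $-\Delta u_j=\tau_ju_j$ on the torus; they depend on $T$. $M^\dagger$ is the transpose of $M$, $T^{-\dagger}=(T^{-1})^\dagger$, and $\lVert M\rVert_{HS}=\big(\sum_{j,k}M_{jk}^2\big)^{1/2}$ is the Hilbert--Schmidt norm. *)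

theory Defs
  imports "HOL-Analysis.Analysis" "HOL-Library.Function_Algebras"
begin

interpretation fun_vs: vector_space "\<lambda>(c::real) (f::'a \<Rightarrow> real) x. c * f x"
  by unfold_locales (auto simp: fun_eq_iff algebra_simps)

definition partial_deriv :: "'d \<Rightarrow> (real^'d \<Rightarrow> real) \<Rightarrow> real^'d \<Rightarrow> real" where
  "partial_deriv i u x = deriv (\<lambda>t. u (x + t *\<^sub>R axis i 1)) 0"

definition C1_fun :: "(real^'d \<Rightarrow> real) \<Rightarrow> bool" where
  "C1_fun u \<longleftrightarrow> (\<forall>x. u differentiable (at x)) \<and> (\<forall>i. continuous_on UNIV (partial_deriv i u))"

definition C2_fun :: "(real^'d \<Rightarrow> real) \<Rightarrow> bool" where
  "C2_fun u \<longleftrightarrow> C1_fun u \<and> (\<forall>i. C1_fun (partial_deriv i u))"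

definition laplacian :: "(real^'d \<Rightarrow> real) \<Rightarrow> real^'d \<Rightarrow> real" where
  "laplacian u x = (\<Sum>i\<in>UNIV. partial_deriv i (partial_deriv i u) x)"

definition lattice_of :: "real^'d^'d \<Rightarrow> (real^'d) set" where
  "lattice_of T = {T *v k | k. \<forall>i. k $ i \<in> \<int>}"

text \<open>Functions on the flat torus of T are identified with the functions on Euclidean space that
  are invariant under translation by the lattice. Eigenfunctions are understood classically;
  by elliptic regularity they are automatically smooth. The zero function belongs to every
  eigenspace, so a real number is an eigenvalue iff its eigenspace is nontrivial.\<close>

definition torus_eigenspace :: "real^'d^'d \<Rightarrow> real \<Rightarrow> (real^'d \<Rightarrow> real) set" where
  "torus_eigenspace T \<mu> =
     {u. C2_fun u \<and> (\<forall>x. \<forall>l\<in>lattice_of T. u (x + l) = u x) \<and> (\<forall>x. - laplacian u x = \<mu> * u x)}"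

text \<open>The predicate says that the sequence, indexed from 1, is nondecreasing and takes each value
  exactly as often as the dimension of its eigenspace (which is 0 if the value is not an
  eigenvalue). The basis is spelled out, rather than using \<open>dim\<close>, because \<open>dim\<close> is 0
  for infinite-dimensional spaces.\<close>

definition torus_eigenvalue_sequence :: "real^'d^'d \<Rightarrow> (nat \<Rightarrow> real) \<Rightarrow> bool" where
  "torus_eigenvalue_sequence T \<tau> \<longleftrightarrow> mono_on {1..} \<tau> \<and>
     (\<forall>\<mu>. finite {j\<in>{1..}. \<tau> j = \<mu>} \<and>
          (\<exists>B. finite B \<and> fun_vs.independent B \<and> fun_vs.span B = torus_eigenspace T \<mu> \<and>
               card B = card {j\<in>{1..}. \<tau> j = \<mu>}))"

text \<open>The values at indices at least 1 are uniquely determined by the predicate above; the value at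
  index 0 is irrelevant.\<close>

definition torus_eigenvalue :: "real^'d^'d \<Rightarrow> nat \<Rightarrow> real" where
  "torus_eigenvalue T = (SOME \<tau>. torus_eigenvalue_sequence T \<tau>)"

definition hs_norm :: "real^'m^'n \<Rightarrow> real" where
  "hs_norm M = sqrt (\<Sum>j\<in>UNIV. \<Sum>k\<in>UNIV. (M $ j $ k)\<^sup>2)"

definition normalized_eigenvalue_sum :: "real^'d^'d \<Rightarrow> nat \<Rightarrow> real" where
  "normalized_eigenvalue_sum T n =
     (\<Sum>j=2..n. torus_eigenvalue T j) * (1 / (hs_norm (transpose (matrix_inv T)))\<^sup>2)"

end

theory Submission
  imports Defs
begin

text \<open>
  Separation into plane waves shows that the eigenvalues of the torus of \<open>T\<close>, counted with
  multiplicity, are the numbers \<open>4\<pi>\<^sup>2\<bar>T\<^bsup>-\<dagger>\<^esup>k\<bar>\<^sup>2\<close> with \<open>k\<close> ranging over the integer vectors; the value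
  \<open>\<tau>\<^sub>1 = 0\<close> belongs to \<open>k = 0\<close>. Consequently \<open>\<tau>\<^sub>2 + \<dots> + \<tau>\<^sub>n\<close> is at most the sum of
  \<open>4\<pi>\<^sup>2\<bar>T\<^bsup>-\<dagger>\<^esup>k\<bar>\<^sup>2\<close> over any \<open>n - 1\<close> distinct nonzero integer vectors
  (\<open>torus_eigenvalue_sum_le\<close>).

  Take vectors \<open>k\<^sub>2, \<dots>, k\<^sub>n\<close> that attain the eigenvalue sum of the cubical torus \<open>S = c Q\<close>, where
  \<open>\<bar>S\<^bsup>-\<dagger>\<^esup>k\<bar> = \<bar>k\<bar> / \<bar>c\<bar>\<close>. Every signed permutation matrix \<open>g\<close> maps them to \<open>n - 1\<close> distinct nonzero
  integer vectors, which are trial vectors for \<open>T\<close>. Averaging the resulting bounds over all \<open>g\<close>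
  (\<open>sum_signed_permutations_norm\<close>) replaces \<open>\<bar>T\<^bsup>-\<dagger>\<^esup>g k\<^sub>j\<bar>\<^sup>2\<close> by \<open>\<parallel>T\<^bsup>-\<dagger>\<^esup>\<parallel>\<^sup>2\<bar>k\<^sub>j\<bar>\<^sup>2 / d\<close>, so the normalized sum
  for \<open>T\<close> is at most \<open>(4\<pi>\<^sup>2 / d) (\<bar>k\<^sub>2\<bar>\<^sup>2 + \<dots> + \<bar>k\<^sub>n\<bar>\<^sup>2)\<close>. For \<open>S\<close> this is an equality, since
  \<open>\<parallel>S\<^bsup>-\<dagger>\<^esup>\<parallel>\<^sup>2 = d / c\<^sup>2\<close>.

  The description of the spectrum (\<open>torus_eigenspace_eq_span\<close>) rests on three facts. The functions
  \<open>cos + sin\<close> of the phase \<open>2\<pi> T\<^bsup>-\<dagger>\<^esup>k \<bullet> x\<close> are orthonormal eigenfunctions; eigenfunctions with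
  different eigenvalues are orthogonal, as the Laplacian is symmetric with respect to the
  translation-invariant mean; and a continuous periodic function orthogonal to all modes vanishes,
  by the Stone--Weierstrass theorem. This also proves that the sequence of eigenvalues exists, so
  that the choice operator in the definition of \<open>torus_eigenvalue\<close> has a witness.
\<close>

section \<open>Ordering and counting\<close>

lemma monotone_enumeration_exists:
  fixes f :: "'a \<Rightarrow> real"
  assumes inf: "infinite X" and fin: "\<And>M. finite {x\<in>X. f x \<le> M}"
  shows "\<exists>e::nat \<Rightarrow> 'a. bij_betw e UNIV X \<and> mono (\<lambda>n. f (e n))"
proof -
  \<comment> \<open>Greedy enumeration: always take a remaining element with the least value.\<close>
  define pick where "pick S = (SOME x. x \<in> X - S \<and> (\<forall>y\<in>X - S. f x \<le> f y))" for S
  have pick: "pick S \<in> X - S \<and> (\<forall>y\<in>X - S. f (pick S) \<le> f y)" if "finite S" for S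
    unfolding pick_def
  proof (rule someI_ex)
    obtain x0 where x0: "x0 \<in> X - S"
      using inf \<open>finite S\<close> by (metis Diff_infinite_finite ex_in_conv finite.emptyI)
    define C where "C = {x\<in>X - S. f x \<le> f x0}"
    have "finite C" "C \<noteq> {}"
      using fin[of "f x0"] x0 by (auto simp: C_def elim: rev_finite_subset)
    then obtain x where "x \<in> C" "\<forall>y\<in>C. f x \<le> f y"
      by (metis arg_min_if_finite(1) arg_min_least)
    then show "\<exists>x. x \<in> X - S \<and> (\<forall>y\<in>X - S. f x \<le> f y)"
      by (intro exI[of _ x]) (force simp: C_def)
  qed
  define S where "S = rec_nat {} (\<lambda>_ A. insert (pick A) A)"
  define e where "e n = pick (S n)" for n
  have S0: "S 0 = {}" and S_Suc: "S (Suc n) = insert (e n) (S n)" for n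
    by (simp_all add: S_def e_def)
  have S_eq: "S n = e ` {..<n}" for n
    by (induction n) (auto simp: S0 S_Suc lessThan_Suc)
  have e: "e n \<in> X" "e n \<notin> e ` {..<n}" "\<And>y. y \<in> X \<Longrightarrow> y \<notin> e ` {..<n} \<Longrightarrow> f (e n) \<le> f y" for n
    using pick[of "S n"] e_def[of n] by (auto simp: S_eq)
  have inj: "inj e"
  proof (rule linorder_injI)
    show "e m \<noteq> e n" if "m < n" for m n
      using e(2)[of n] that by (metis imageI lessThan_iff)
  qed
  have mono: "mono (\<lambda>n. f (e n))"
  proof (rule monoI)
    fix m n :: nat assume "m \<le> n"
    then have "e n \<notin> e ` {..<m}"
      using e(2)[of n] by (meson image_mono lessThan_subset_iff subsetD)
    then show "f (e m) \<le> f (e n)"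
      using e(3)[OF e(1)] by blast
  qed
  \<comment> \<open>An element never picked would bound the values of infinitely many picked ones.\<close>
  have "x \<in> range e" if "x \<in> X" for x
  proof (rule ccontr)
    assume "x \<notin> range e"
    then have "f (e n) \<le> f x" for n
      using e(3)[OF that, of n] by blast
    then have "range e \<subseteq> {y\<in>X. f y \<le> f x}"
      using e(1) by blast
    then have "finite (range e)"
      using fin finite_subset by blast
    then show False
      using inj finite_imageD infinite_UNIV_nat by blast
  qed
  then have "bij_betw e UNIV X"
    using inj e(1) by (auto simp: bij_betw_def)
  with mono show ?thesis by blast
qed

text \<open>Functions whose fibres over every value are finite and equinumerous differ by a bijection of
  their domains.\<close>

lemma fibrewise_bijection_exists:
  assumes J: "\<And>\<mu>. finite {j\<in>J. \<tau> j = \<mu>}" and X: "\<And>\<mu>. finite {x\<in>X. f x = \<mu>}"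
    and card: "\<And>\<mu>. card {j\<in>J. \<tau> j = \<mu>} = card {x\<in>X. f x = \<mu>}"
  shows "\<exists>e. bij_betw e J X \<and> (\<forall>j\<in>J. f (e j) = \<tau> j)"
proof -
  have "\<exists>b. bij_betw b {j\<in>J. \<tau> j = \<mu>} {x\<in>X. f x = \<mu>}" for \<mu>
    using finite_same_card_bij[OF J X card] .
  then obtain b where b: "\<And>\<mu>. bij_betw (b \<mu>) {j\<in>J. \<tau> j = \<mu>} {x\<in>X. f x = \<mu>}"
    by metis
  define e where "e j = b (\<tau> j) j" for j
  have e: "e j \<in> X \<and> f (e j) = \<tau> j" if "j \<in> J" for j
    using bij_betwE[OF b[of "\<tau> j"]] that by (auto simp: e_def)
  have "inj_on e J"
  proof (rule inj_onI)
    fix i j assume ij: "i \<in> J" "j \<in> J" "e i = e j"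
    then have "\<tau> i = \<tau> j" using e by metis
    then show "i = j"
      using ij bij_betw_imp_inj_on[OF b[of "\<tau> j"]] by (auto simp: e_def dest: inj_onD)
  qed
  moreover have "x \<in> e ` J" if "x \<in> X" for x
  proof -
    have "x \<in> b (f x) ` {j\<in>J. \<tau> j = f x}"
      using bij_betw_imp_surj_on[OF b[of "f x"]] that by simp
    then obtain j where "j \<in> J" "\<tau> j = f x" "x = b (f x) j"
      by auto
    then have "x = e j" by (simp add: e_def)
    then show ?thesis using \<open>j \<in> J\<close> by blast
  qed
  ultimately have "bij_betw e J X"
    using e by (auto simp: bij_betw_def)
  then show ?thesis using e by blast
qed

lemma sum_initial_segment_le:
  fixes \<tau> :: "nat \<Rightarrow> real"
  assumes mono: "mono_on {1..} \<tau>" and J: "finite J" "J \<subseteq> {2..}" "card J = card {2..n}"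
  shows "(\<Sum>j=2..n. \<tau> j) \<le> (\<Sum>j\<in>J. \<tau> j)"
proof -
  let ?I = "{2..n}"
  have *: "sum \<tau> ?I = sum \<tau> (?I \<inter> J) + sum \<tau> (?I - J)"
    "sum \<tau> J = sum \<tau> (?I \<inter> J) + sum \<tau> (J - ?I)"
    using sum.Int_Diff[of ?I \<tau> J] sum.Int_Diff[of J \<tau> ?I] J(1) by (auto simp: Int_commute)
  have card: "card (?I - J) = card (J - ?I)"
    using J by (simp add: card_Diff_subset_Int Int_commute)
  have "sum \<tau> (?I - J) \<le> of_nat (card (?I - J)) * \<tau> n"
    by (rule sum_bounded_above) (auto intro!: mono_onD[OF mono])
  also have "\<dots> \<le> sum \<tau> (J - ?I)"
    unfolding card
  proof (rule sum_bounded_below)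
    fix j assume j: "j \<in> J - ?I"
    then have "?I - J \<noteq> {}"
      using card J(1) by (metis card_0_eq card.empty finite_Diff empty_iff)
    then show "\<tau> n \<le> \<tau> j"
      using j J(2) by (intro mono_onD[OF mono]) auto
  qed
  finally show ?thesis using * by simp
qed

section \<open>Averaging over signed permutations\<close>

text \<open>The vectors of signs: functions from the index set to \<open>{-1, 1}\<close>. As the domain is the whole
  type, the extensional function space is the full one.\<close>

definition sign_functions :: "('d::finite \<Rightarrow> real) set" where
  "sign_functions = UNIV \<rightarrow>\<^sub>E {-1, 1}"

lemma finite_sign_functions [simp]: "finite sign_functions"
  by (simp add: sign_functions_def finite_PiE)

lemma sum_sign_functions:
  "(\<Sum>s\<in>sign_functions. s i * s l) = (if i = l then real (card (sign_functions :: ('d::finite \<Rightarrow> real) set)) else 0)"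
  for i l :: "'d::finite"
proof (cases "i = l")
  case True
  have "s l * s l = 1" if "s \<in> sign_functions" for s :: "'d \<Rightarrow> real"
  proof -
    have "s l \<in> {-1, 1}" using that by (auto simp: sign_functions_def)
    then show ?thesis by auto
  qed
  then show ?thesis using True by simp
next
  case False
  \<comment> \<open>Flipping the sign at \<open>i\<close> is an involution that negates every term.\<close>
  have "(\<Sum>s\<in>sign_functions. s i * s l) = (\<Sum>s\<in>sign_functions. - (s i * s l))"
    by (rule sum.reindex_bij_witness[where i = "\<lambda>s. s(i := - s i)" and j = "\<lambda>s. s(i := - s i)"])
      (use False in \<open>auto simp: sign_functions_def PiE_iff\<close>)
  then show ?thesis using False by (simp add: sum_negf)
qed

lemma sum_bijections_eval:
  fixes f :: "'d::finite \<Rightarrow> real" and i :: 'd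
  shows "real CARD('d) * (\<Sum>p::'d\<Rightarrow>'d | bij p. f (p i)) = real (card {p::'d \<Rightarrow> 'd. bij p}) * (\<Sum>l\<in>UNIV. f l)"
proof -
  have eq: "(\<Sum>p::'d\<Rightarrow>'d | bij p. f (p l)) = (\<Sum>p::'d\<Rightarrow>'d | bij p. f (p i))" for l
    by (rule sum.reindex_bij_witness[where i = "\<lambda>p. p \<circ> Transposition.transpose i l"
          and j = "\<lambda>p. p \<circ> Transposition.transpose i l"])
      (auto simp: fun_eq_iff bij_comp)
  have "(\<Sum>l\<in>UNIV. \<Sum>p::'d\<Rightarrow>'d | bij p. f (p l)) = (\<Sum>l\<in>(UNIV::'d set). \<Sum>p::'d\<Rightarrow>'d | bij p. f (p i))"
    by (rule sum.cong[OF refl eq])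
  then have "real CARD('d) * (\<Sum>p::'d\<Rightarrow>'d | bij p. f (p i)) = (\<Sum>l\<in>UNIV. \<Sum>p::'d\<Rightarrow>'d | bij p. f (p l))"
    by simp
  also have "\<dots> = (\<Sum>p::'d\<Rightarrow>'d | bij p. \<Sum>l\<in>UNIV. f (p l))"
    by (rule sum.swap)
  also have "\<dots> = (\<Sum>p::'d\<Rightarrow>'d | bij p. \<Sum>l\<in>UNIV. f l)"
  proof (rule sum.cong[OF refl])
    fix p :: "'d \<Rightarrow> 'd" assume "p \<in> {p. bij p}"
    then show "(\<Sum>l\<in>UNIV. f (p l)) = (\<Sum>l\<in>UNIV. f l)"
      using sum.reindex_bij_betw[of p UNIV UNIV f] by simp
  qed
  finally show ?thesis by simp
qed

text \<open>The signed permutation given by a pair \<open>g = (p, s)\<close> of an index map \<open>p\<close> and a sign vector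
  \<open>s\<close>: the vector \<open>k\<close> is sent to the vector with entries \<open>s i * k $ p i\<close>.\<close>

definition signed_permutation :: "('d \<Rightarrow> 'd) \<times> ('d \<Rightarrow> real) \<Rightarrow> real^'d \<Rightarrow> real^'d" where
  "signed_permutation g k = (\<chi> i. snd g i * k $ fst g i)"

text \<open>The hyperoctahedral group, as a set of pairs; no group structure is needed.\<close>

definition signed_permutations :: "(('d::finite \<Rightarrow> 'd) \<times> ('d \<Rightarrow> real)) set" where
  "signed_permutations = {p. bij p} \<times> sign_functions"

lemma finite_signed_permutations: "finite signed_permutations"
  by (simp add: signed_permutations_def)

lemma signed_permutations_nonempty: "signed_permutations \<noteq> {}"
proof -
  have "(id, \<lambda>_. 1) \<in> signed_permutations"
    by (auto simp: signed_permutations_def sign_functions_def)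
  then show ?thesis by blast
qed

lemma norm_matrix_vector_power2:
  fixes A :: "real^'d^'d"
  shows "(norm (A *v v))\<^sup>2 = (\<Sum>m\<in>UNIV. \<Sum>i\<in>UNIV. \<Sum>l\<in>UNIV. A$m$i * A$m$l * (v$i * v$l))"
  unfolding power2_norm_eq_inner inner_vec_def
  by (simp add: matrix_vector_mult_def sum_product mult_ac)

text \<open>The tight frame identity: the average of \<open>\<bar>A (g k)\<bar>\<^sup>2\<close> over all signed permutations \<open>g\<close> is
  \<open>\<parallel>A\<parallel>\<^sup>2 \<bar>k\<bar>\<^sup>2 / d\<close>, with the Hilbert--Schmidt norm of \<open>A\<close>. Averaging over the signs removes the
  mixed terms, and averaging over the permutations replaces each squared entry of \<open>k\<close> by
  \<open>\<bar>k\<bar>\<^sup>2 / d\<close>.\<close>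

lemma sum_signed_permutations_norm:
  fixes A :: "real^'d^'d" and k :: "real^'d"
  shows "real CARD('d) * (\<Sum>g\<in>signed_permutations. (norm (A *v signed_permutation g k))\<^sup>2)
    = real (card (signed_permutations :: (('d \<Rightarrow> 'd) \<times> ('d \<Rightarrow> real)) set)) * ((hs_norm A)\<^sup>2 * (norm k)\<^sup>2)"
proof -
  let ?N = "real (card (sign_functions :: ('d \<Rightarrow> real) set))"
  let ?P = "real (card {p::'d \<Rightarrow> 'd. bij p})"
  have signs: "(\<Sum>s\<in>sign_functions. (norm (A *v signed_permutation (p, s) k))\<^sup>2)
      = ?N * (\<Sum>m\<in>UNIV. \<Sum>i\<in>UNIV. (A$m$i)\<^sup>2 * (k $ p i)\<^sup>2)" for p
  proof -
    have "(\<Sum>s\<in>sign_functions. (norm (A *v signed_permutation (p, s) k))\<^sup>2)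
        = (\<Sum>s\<in>sign_functions. \<Sum>m\<in>UNIV. \<Sum>i\<in>UNIV. \<Sum>l\<in>UNIV.
            A$m$i * A$m$l * (k $ p i * k $ p l) * (s i * s l))"
      by (simp add: norm_matrix_vector_power2 signed_permutation_def mult_ac)
    also have "\<dots> = (\<Sum>m\<in>UNIV. \<Sum>i\<in>UNIV. \<Sum>l\<in>UNIV.
            A$m$i * A$m$l * (k $ p i * k $ p l) * (\<Sum>s\<in>sign_functions. s i * s l))"
      unfolding sum_distrib_left by ((rule trans[OF sum.swap], rule sum.cong[OF refl])+, rule refl)
    also have "\<dots> = (\<Sum>m\<in>UNIV. \<Sum>i\<in>UNIV. A$m$i * A$m$i * (k $ p i * k $ p i) * ?N)"
      by (simp add: sum_sign_functions if_distrib cong: if_cong)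
    finally show ?thesis
      by (simp add: sum_distrib_left power2_eq_square mult_ac)
  qed
  have "real CARD('d) * (\<Sum>g\<in>signed_permutations. (norm (A *v signed_permutation g k))\<^sup>2)
      = real CARD('d) * (\<Sum>p | bij p. \<Sum>s\<in>sign_functions. (norm (A *v signed_permutation (p, s) k))\<^sup>2)"
    by (simp add: signed_permutations_def sum.cartesian_product)
  also have "\<dots> = real CARD('d) * (\<Sum>p | bij p. ?N * (\<Sum>m\<in>UNIV. \<Sum>i\<in>UNIV. (A$m$i)\<^sup>2 * (k $ p i)\<^sup>2))"
    by (simp add: signs)
  also have "\<dots> = ?N * (\<Sum>m\<in>UNIV. \<Sum>i\<in>UNIV. (A$m$i)\<^sup>2 * (real CARD('d) * (\<Sum>p | bij p. (k $ p i)\<^sup>2)))"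
  proof -
    have "(\<Sum>p | bij p. \<Sum>m\<in>UNIV. \<Sum>i\<in>UNIV. (A$m$i)\<^sup>2 * (k $ p i)\<^sup>2)
        = (\<Sum>m\<in>UNIV. \<Sum>i\<in>UNIV. (A$m$i)\<^sup>2 * (\<Sum>p | bij p. (k $ p i)\<^sup>2))"
      unfolding sum_distrib_left by ((rule trans[OF sum.swap], rule sum.cong[OF refl])+, rule refl)
    then show ?thesis
      by (simp add: mult_ac flip: sum_distrib_left)
  qed
  also have "\<dots> = ?N * (\<Sum>m\<in>UNIV. \<Sum>i\<in>UNIV. (A$m$i)\<^sup>2 * (?P * (norm k)\<^sup>2))"
  proof -
    have "real CARD('d) * (\<Sum>p | bij p. (k $ p i)\<^sup>2) = ?P * (norm k)\<^sup>2" for i :: 'd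
      using sum_bijections_eval[of "\<lambda>l. (k $ l)\<^sup>2" i]
      unfolding power2_norm_eq_inner inner_vec_def by (simp add: power2_eq_square)
    then show ?thesis by simp
  qed
  also have "\<dots> = ?N * ?P * ((\<Sum>m\<in>UNIV. \<Sum>i\<in>UNIV. (A$m$i)\<^sup>2) * (norm k)\<^sup>2)"
    by (simp add: sum_distrib_left sum_distrib_right mult_ac)
  also have "(\<Sum>m\<in>UNIV. \<Sum>i\<in>UNIV. (A$m$i)\<^sup>2) = (hs_norm A)\<^sup>2"
    by (simp add: hs_norm_def sum_nonneg)
  finally show ?thesis
    by (simp add: signed_permutations_def mult_ac)
qed

text \<open>The standard integer lattice.\<close>

definition integer_vectors :: "(real^'d) set" where
  "integer_vectors = {k. \<forall>i. k $ i \<in> \<int>}"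

lemma signed_permutation_integer:
  assumes "g \<in> signed_permutations" "k \<in> integer_vectors"
  shows "signed_permutation g k \<in> integer_vectors"
proof -
  have "snd g i \<in> {-1, 1}" for i
    using assms(1) by (auto simp: signed_permutations_def sign_functions_def)
  then have "snd g i \<in> \<int>" for i
    by (metis Ints_1 Ints_minus empty_iff insert_iff)
  then show ?thesis
    using assms(2) by (simp add: integer_vectors_def signed_permutation_def)
qed

lemma inj_signed_permutation:
  assumes "g \<in> signed_permutations"
  shows "inj (signed_permutation g)"
proof (rule injI)
  fix k l assume eq: "signed_permutation g k = signed_permutation g l"
  have "snd g i \<in> {-1, 1}" for i
    using assms by (auto simp: signed_permutations_def sign_functions_def)
  then have "snd g i \<noteq> 0" for i
    by (metis empty_iff insert_iff neg_equal_0_iff_equal zero_neq_one)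
  then have "k $ fst g i = l $ fst g i" for i
    using eq by (simp add: signed_permutation_def vec_eq_iff)
  moreover have "surj (fst g)"
    using assms by (auto simp: signed_permutations_def bij_is_surj)
  ultimately show "k = l"
    by (metis vec_eq_iff surjD)
qed

section \<open>Partial derivatives and plane waves\<close>

lemma sum_fun_apply: "(\<Sum>i\<in>I. f i) x = (\<Sum>i\<in>I. f i x :: real)"
  by (induction I rule: infinite_finite_induct) auto

lemma differentiable_DERIV_axis:
  fixes u :: "real^'d \<Rightarrow> real"
  assumes "u differentiable (at x)"
  shows "((\<lambda>t. u (x + t *\<^sub>R axis i 1)) has_field_derivative partial_deriv i u x) (at 0)"
proof -
  have "(\<lambda>t. u (x + t *\<^sub>R axis i 1)) differentiable (at 0)"
  proof (rule differentiable_compose[where f = u])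
    show "(\<lambda>t. x + t *\<^sub>R axis i 1) differentiable (at 0)"
      unfolding differentiable_def by (rule exI) (auto intro!: derivative_eq_intros)
  qed (use assms in auto)
  then show ?thesis
    unfolding partial_deriv_def by (simp add: DERIV_deriv_iff_real_differentiable)
qed

lemma DERIV_axis_shift:
  fixes u :: "real^'d \<Rightarrow> real"
  assumes "\<And>x. ((\<lambda>t. u (x + t *\<^sub>R axis i 1)) has_field_derivative u' x) (at 0)"
  shows "((\<lambda>t. u (x + t *\<^sub>R axis i 1)) has_field_derivative u' (x + t *\<^sub>R axis i 1)) (at t)"
proof -
  have "((\<lambda>s. u (x + (s + t) *\<^sub>R axis i 1)) has_field_derivative u' (x + t *\<^sub>R axis i 1)) (at 0)"
    using assms[of "x + t *\<^sub>R axis i 1"] by (simp add: algebra_simps)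
  then show ?thesis
    using DERIV_shift[of "\<lambda>s. u (x + s *\<^sub>R axis i 1)" "u' (x + t *\<^sub>R axis i 1)" 0 t] by simp
qed

lemma partial_derivI:
  assumes "\<And>x. ((\<lambda>t. u (x + t *\<^sub>R axis i 1)) has_field_derivative u' x) (at 0)"
  shows "partial_deriv i u = u'"
  using assms by (auto simp: partial_deriv_def fun_eq_iff intro!: DERIV_imp_deriv)

lemma C1_fun_DERIV:
  assumes "C1_fun u"
  shows "((\<lambda>t. u (x + t *\<^sub>R axis i 1)) has_field_derivative partial_deriv i u x) (at 0)"
  by (rule differentiable_DERIV_axis) (use assms in \<open>auto simp: C1_fun_def\<close>)

lemma C1_fun_continuous: "C1_fun u \<Longrightarrow> continuous_on S u"
  unfolding C1_fun_def
  by (meson continuous_at_imp_continuous_on differentiable_imp_continuous_within)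

lemma C2_fun_imp_C1: "C2_fun u \<Longrightarrow> C1_fun u" "C2_fun u \<Longrightarrow> C1_fun (partial_deriv i u)"
  by (auto simp: C2_fun_def)

lemma partial_deriv_add:
  "C1_fun u \<Longrightarrow> C1_fun v \<Longrightarrow> partial_deriv i (u + v) = partial_deriv i u + partial_deriv i v"
  by (rule partial_derivI) (auto intro!: derivative_eq_intros C1_fun_DERIV)

lemma partial_deriv_scale:
  "C1_fun u \<Longrightarrow> partial_deriv i (\<lambda>x. c * u x) = (\<lambda>x. c * partial_deriv i u x)"
  by (rule partial_derivI) (auto intro!: derivative_eq_intros C1_fun_DERIV)

lemma C1_fun_add:
  assumes "C1_fun u" "C1_fun v"
  shows "C1_fun (u + v)"
  unfolding C1_fun_def partial_deriv_add[OF assms]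
  using assms by (auto simp: C1_fun_def plus_fun_def intro: continuous_on_add)

lemma C1_fun_scale:
  assumes "C1_fun u"
  shows "C1_fun (\<lambda>x. c * u x)"
  unfolding C1_fun_def partial_deriv_scale[OF assms]
  using assms by (auto simp: C1_fun_def intro: continuous_on_mult_left)

lemma C2_fun_add: "C2_fun u \<Longrightarrow> C2_fun v \<Longrightarrow> C2_fun (u + v)"
  by (simp add: C2_fun_def partial_deriv_add C1_fun_add)

lemma C2_fun_scale: "C2_fun u \<Longrightarrow> C2_fun (\<lambda>x. c * u x)"
  by (simp add: C2_fun_def partial_deriv_scale C1_fun_scale)

lemma laplacian_add:
  "C2_fun u \<Longrightarrow> C2_fun v \<Longrightarrow> laplacian (u + v) x = laplacian u x + laplacian v x"
  by (simp add: laplacian_def C2_fun_imp_C1 partial_deriv_add sum.distrib)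

lemma laplacian_scale: "C2_fun u \<Longrightarrow> laplacian (\<lambda>x. c * u x) y = c * laplacian u y"
  by (simp add: laplacian_def C2_fun_imp_C1 partial_deriv_scale sum_distrib_left)

text \<open>The general real plane wave of frequency \<open>\<xi>\<close>. For fixed \<open>\<xi>\<close> this two-parameter family is closed
  under differentiation.\<close>

definition plane_wave :: "real^'d \<Rightarrow> real \<Rightarrow> real \<Rightarrow> real^'d \<Rightarrow> real" where
  "plane_wave \<xi> a b = (\<lambda>x. a * cos (\<xi> \<bullet> x) + b * sin (\<xi> \<bullet> x))"

lemma partial_deriv_plane_wave:
  "partial_deriv i (plane_wave \<xi> a b) = plane_wave \<xi> (b * \<xi> $ i) (- (a * \<xi> $ i))"
  unfolding plane_wave_def
  by (rule partial_derivI)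
    (auto intro!: derivative_eq_intros simp: inner_add_right inner_axis algebra_simps)

lemma C1_fun_plane_wave: "C1_fun (plane_wave \<xi> a b)"
proof -
  have "plane_wave \<xi> a b differentiable (at x)" for a b x
    unfolding plane_wave_def differentiable_def by (rule exI) (auto intro!: derivative_eq_intros)
  moreover have "continuous_on UNIV (plane_wave \<xi> a b)" for a b
    unfolding plane_wave_def by (intro continuous_intros)
  ultimately show ?thesis
    by (simp add: C1_fun_def partial_deriv_plane_wave)
qed

lemma C2_fun_plane_wave: "C2_fun (plane_wave \<xi> a b)"
  by (simp add: C2_fun_def partial_deriv_plane_wave C1_fun_plane_wave)

lemma laplacian_plane_wave:
  "laplacian (plane_wave \<xi> a b) x = - ((norm \<xi>)\<^sup>2 * plane_wave \<xi> a b x)"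
proof -
  have "laplacian (plane_wave \<xi> a b) x = (\<Sum>i\<in>UNIV. - ((\<xi> $ i * \<xi> $ i) * plane_wave \<xi> a b x))"
    unfolding laplacian_def partial_deriv_plane_wave by (simp add: plane_wave_def algebra_simps)
  also have "\<dots> = - ((\<xi> \<bullet> \<xi>) * plane_wave \<xi> a b x)"
    by (simp add: inner_vec_def sum_negf sum_distrib_right)
  finally show ?thesis by (simp add: power2_norm_eq_inner)
qed

section \<open>Translation invariance of the mean over a torus\<close>

abbreviation unit_cube :: "(real^'d) set" where
  "unit_cube \<equiv> cbox 0 1"

text \<open>The translated cube is cut by the face of the unit cube that it crosses, and the protruding
  slab is moved back by periodicity.\<close>

lemma integral_unit_cube_shift_axis_le_1:
  fixes w :: "real^'d \<Rightarrow> real"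
  assumes cont: "continuous_on UNIV w" and per: "\<And>y. w (y + axis i 1) = w y"
    and t: "0 \<le> t" "t \<le> 1"
  shows "integral unit_cube (\<lambda>y. w (y + t *\<^sub>R axis i 1)) = integral unit_cube w"
proof -
  let ?e = "axis i 1 :: real^'d"
  define a where "a = t *\<^sub>R ?e"
  define b where "b = 1 - (1 - t) *\<^sub>R ?e"
  have int: "w integrable_on cbox c d" for c d
    by (rule integrable_continuous) (use cont continuous_on_subset in blast)
  have Basis: "?e \<in> Basis" by (simp add: axis_in_Basis_iff)
  have ev: "?e $ j = (if j = i then 1 else 0)" for j by (simp add: axis_def)
  have b_eq: "(\<chi> j. if j = i then min ((1::real^'d) $ i) t else 1 $ j) = b"
    and a_eq: "(\<chi> j. if j = i then max ((0::real^'d) $ i) t else 0 $ j) = a"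
    and one_eq: "(\<chi> j. if j = i then min ((1 + a) $ i) 1 else (1 + a) $ j) = 1"
    and e_eq: "(\<chi> j. if j = i then max (a $ i) 1 else a $ j) = ?e"
    and be_eq: "1 + a = b + ?e"
    using t by (auto simp: vec_eq_iff a_def b_def ev)
  note split = interval_split_cart[unfolded interval_cbox_cart]
  have 1: "unit_cube \<inter> {x. x \<bullet> ?e \<le> t} = cbox 0 b"
    using t split(1)[where a = 0 and b = 1 and k = i and c = t] by (simp add: inner_axis b_eq)
  have 2: "unit_cube \<inter> {x. t \<le> x \<bullet> ?e} = cbox a 1"
    using t split(2)[where a = 0 and b = 1 and k = i and c = t] by (simp add: inner_axis a_eq)
  have 3: "cbox a (1 + a) \<inter> {x. x \<bullet> ?e \<le> 1} = cbox a 1"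
    using t split(1)[where a = a and b = "1 + a" and k = i and c = 1] by (simp add: inner_axis one_eq)
  have 4: "cbox a (1 + a) \<inter> {x. 1 \<le> x \<bullet> ?e} = cbox (0 + ?e) (b + ?e)"
    using t split(2)[where a = a and b = "1 + a" and k = i and c = 1] by (simp add: inner_axis e_eq be_eq)
  have "integral unit_cube (\<lambda>y. w (y + t *\<^sub>R ?e)) = integral (cbox a (1 + a)) w"
    using integral_shift_cbox[of a a "1 + a" w] by (simp add: a_def)
  also have "\<dots> = integral (cbox a 1) w + integral (cbox (0 + ?e) (b + ?e)) w"
    using integral_split[OF int Basis, of a "1 + a" 1] by (simp only: 3 4)
  also have "integral (cbox (0 + ?e) (b + ?e)) w = integral (cbox 0 b) w"
    using integral_shift_cbox_plus[of 0 b w ?e] per by (simp add: comp_def add.commute)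
  also have "integral (cbox a 1) w + integral (cbox 0 b) w = integral unit_cube w"
    using integral_split[OF int Basis, of 0 1 t] by (simp only: 1 2 add.commute)
  finally show ?thesis .
qed

lemma integral_unit_cube_shift:
  fixes w :: "real^'d \<Rightarrow> real"
  assumes cont: "continuous_on UNIV w" and per: "\<And>y k. k \<in> integer_vectors \<Longrightarrow> w (y + k) = w y"
  shows "integral unit_cube (\<lambda>y. w (y + h)) = integral unit_cube w"
proof -
  have axis: "integral unit_cube (\<lambda>y. v (y + t *\<^sub>R axis i 1)) = integral unit_cube v"
    if v: "continuous_on UNIV v" "\<And>y k. k \<in> integer_vectors \<Longrightarrow> v (y + k) = v y"
    for v :: "real^'d \<Rightarrow> real" and t i
  proof -
    have int: "of_int m *\<^sub>R axis i 1 \<in> integer_vectors" for m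
      by (auto simp: integer_vectors_def axis_def)
    have "v (y + t *\<^sub>R axis i 1) = v (y + frac t *\<^sub>R axis i 1)" for y
      using v(2)[OF int, of "y + frac t *\<^sub>R axis i 1" "\<lfloor>t\<rfloor>"]
      by (simp add: frac_def algebra_simps)
    moreover have "v (y + axis i 1) = v y" for y
      using v(2)[OF int, of y 1] by simp
    ultimately show ?thesis
      using integral_unit_cube_shift_axis_le_1[OF v(1), of i "frac t"]
      by (simp add: frac_lt_1 less_imp_le)
  qed
  \<comment> \<open>Translate one coordinate at a time.\<close>
  have "integral unit_cube (\<lambda>y. w (y + (\<Sum>i\<in>I. (h $ i) *\<^sub>R axis i 1))) = integral unit_cube w" for I
  proof (induction I rule: infinite_finite_induct)
    case (insert i I)
    let ?s = "\<Sum>i\<in>I. (h $ i) *\<^sub>R axis i 1"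
    have "integral unit_cube (\<lambda>y. w ((y + (h $ i) *\<^sub>R axis i 1) + ?s)) = integral unit_cube (\<lambda>y. w (y + ?s))"
    proof (rule axis)
      show "continuous_on UNIV (\<lambda>y. w (y + ?s))"
        by (intro continuous_on_compose2[OF cont] continuous_intros) auto
      show "w ((y + k) + ?s) = w (y + ?s)" if "k \<in> integer_vectors" for y k
        using per[OF that, of "y + ?s"] by (simp add: add_ac)
    qed
    then show ?case using insert by (simp add: add_ac)
  qed auto
  from this[of UNIV] show ?thesis
    by (simp add: basis_expansion scalar_mult_eq_scaleR[symmetric])
qed

text \<open>The matrix \<open>T\<^bsup>-\<dagger>\<^esup>\<close>; its image of the integer lattice is the dual lattice of the torus. It is a
  definition rather than an abbreviation so that the simplifier does not turn its action into a
  row-vector product.\<close>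

definition dual_matrix :: "real^'d^'d \<Rightarrow> real^'d^'d" where
  "dual_matrix T = transpose (matrix_inv T)"

lemma matrix_inv_vector:
  fixes T :: "real^'d^'d"
  assumes "invertible T"
  shows "T *v (matrix_inv T *v x) = x" "matrix_inv T *v (T *v x) = x"
proof -
  have "T ** matrix_inv T = mat 1 \<and> matrix_inv T ** T = mat 1"
    using assms unfolding invertible_def matrix_inv_def by (rule someI_ex)
  then show "T *v (matrix_inv T *v x) = x" "matrix_inv T *v (T *v x) = x"
    by (simp_all add: matrix_vector_mul_assoc)
qed

lemma dual_matrix_inner: "(dual_matrix T *v k) \<bullet> x = k \<bullet> (matrix_inv T *v x)"
  by (simp add: dual_matrix_def dot_lmul_matrix)

lemma dual_matrix_eq_0_iff:
  fixes T :: "real^'d^'d"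
  assumes "invertible T"
  shows "dual_matrix T *v k = 0 \<longleftrightarrow> k = 0"
proof
  assume "dual_matrix T *v k = 0"
  then have "k \<bullet> k = 0"
    using dual_matrix_inner[of T k "T *v k"] by (simp add: matrix_inv_vector[OF assms])
  then show "k = 0" by simp
qed simp

lemma integer_vectors_closed:
  "0 \<in> integer_vectors"
  "k \<in> integer_vectors \<Longrightarrow> l \<in> integer_vectors \<Longrightarrow> k + l \<in> integer_vectors"
  "k \<in> integer_vectors \<Longrightarrow> l \<in> integer_vectors \<Longrightarrow> k - l \<in> integer_vectors"
  "k \<in> integer_vectors \<Longrightarrow> - k \<in> integer_vectors"
  "axis i 1 \<in> integer_vectors"
  by (auto simp: integer_vectors_def axis_def)

lemma lattice_of_eq: "lattice_of T = (\<lambda>k. T *v k) ` integer_vectors"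
  by (auto simp: lattice_of_def integer_vectors_def)

text \<open>Invariance under the lattice, that is, being a function on the torus.\<close>

definition torus_periodic :: "real^'d^'d \<Rightarrow> (real^'d \<Rightarrow> real) \<Rightarrow> bool" where
  "torus_periodic T u \<longleftrightarrow> (\<forall>x. \<forall>l\<in>lattice_of T. u (x + l) = u x)"

lemma torus_periodicD: "torus_periodic T u \<Longrightarrow> k \<in> integer_vectors \<Longrightarrow> u (x + T *v k) = u x"
  by (auto simp: torus_periodic_def lattice_of_eq)

lemma torus_periodic_partial_deriv:
  assumes "torus_periodic T u"
  shows "torus_periodic T (partial_deriv i u)"
  unfolding torus_periodic_def partial_deriv_def
proof (intro allI ballI)
  fix x l assume "l \<in> lattice_of T"
  then have "u (x + l + t *\<^sub>R axis i 1) = u (x + t *\<^sub>R axis i 1)" for t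
    using assms unfolding torus_periodic_def by (metis add.assoc add.commute)
  then show "deriv (\<lambda>t. u (x + l + t *\<^sub>R axis i 1)) 0 = deriv (\<lambda>t. u (x + t *\<^sub>R axis i 1)) 0"
    by simp
qed

text \<open>The mean over the torus, computed in the coordinates of the fundamental cell, so that the
  volume is normalized to 1.\<close>

definition torus_mean :: "real^'d^'d \<Rightarrow> (real^'d \<Rightarrow> real) \<Rightarrow> real" where
  "torus_mean T w = integral unit_cube (\<lambda>y. w (T *v y))"

lemma continuous_on_torus_coordinates:
  fixes T :: "real^'d^'d"
  assumes "continuous_on UNIV w"
  shows "continuous_on S (\<lambda>y. w (T *v y))"
  by (rule continuous_on_compose2[OF assms matrix_vector_mult_linear_continuous_on]) auto

lemma torus_integrable:
  fixes T :: "real^'d^'d" and w :: "real^'d \<Rightarrow> real"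
  assumes "continuous_on UNIV w"
  shows "(\<lambda>y. w (T *v y)) integrable_on unit_cube"
  by (rule integrable_continuous[OF continuous_on_torus_coordinates[OF assms]])

lemma torus_mean_add:
  fixes T :: "real^'d^'d"
  assumes "continuous_on UNIV v" "continuous_on UNIV w"
  shows "torus_mean T (\<lambda>x. v x + w x) = torus_mean T v + torus_mean T w"
  unfolding torus_mean_def by (intro integral_add torus_integrable assms)

lemma torus_mean_diff:
  assumes "continuous_on UNIV v" "continuous_on UNIV w"
  shows "torus_mean T (\<lambda>x. v x - w x) = torus_mean T v - torus_mean T w"
  unfolding torus_mean_def by (intro integral_diff torus_integrable assms)

lemma torus_mean_cmult: "torus_mean T (\<lambda>x. c * w x) = c * torus_mean T w"
  unfolding torus_mean_def by simp

lemma torus_mean_sum: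
  assumes "finite I" "\<And>i. i \<in> I \<Longrightarrow> continuous_on UNIV (w i)"
  shows "torus_mean T (\<lambda>x. \<Sum>i\<in>I. w i x) = (\<Sum>i\<in>I. torus_mean T (w i))"
  unfolding torus_mean_def by (intro integral_sum torus_integrable assms)

lemma torus_mean_const: "torus_mean T (\<lambda>x. c) = c" for T :: "real^'d^'d"
proof -
  have "(0 :: real^'d) \<in> unit_cube"
    by (simp add: mem_box_cart)
  then have "measure lborel (unit_cube :: (real^'d) set) = 1"
    by (subst content_cbox_cart) auto
  then show ?thesis by (simp add: torus_mean_def)
qed

lemma torus_mean_shift:
  fixes T :: "real^'d^'d"
  assumes "invertible T" and cont: "continuous_on UNIV w" and per: "torus_periodic T w"
  shows "torus_mean T (\<lambda>x. w (x + h)) = torus_mean T w"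
proof -
  have "integral unit_cube (\<lambda>y. w (T *v (y + matrix_inv T *v h))) = integral unit_cube (\<lambda>y. w (T *v y))"
  proof (rule integral_unit_cube_shift)
    show "continuous_on UNIV (\<lambda>y. w (T *v y))"
      by (rule continuous_on_torus_coordinates[OF cont])
    show "w (T *v (y + k)) = w (T *v y)" if "k \<in> integer_vectors" for y k
      using torus_periodicD[OF per that] by (simp add: matrix_vector_right_distrib)
  qed
  then show ?thesis
    by (simp add: torus_mean_def matrix_vector_right_distrib matrix_inv_vector[OF assms(1)])
qed

text \<open>Integration by parts on the torus: the mean of a directional derivative vanishes, because the
  mean of the translates \<open>w (x + t e\<^sub>i)\<close> does not depend on \<open>t\<close> and may be differentiated under
  the integral.\<close>

lemma torus_mean_derivative_eq_0:
  fixes T :: "real^'d^'d"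
  assumes "invertible T" and per: "torus_periodic T w"
    and deriv: "\<And>x. ((\<lambda>t. w (x + t *\<^sub>R axis i 1)) has_field_derivative w' x) (at 0)"
    and cont: "continuous_on UNIV w" and cont': "continuous_on UNIV w'"
  shows "torus_mean T w' = 0"
proof -
  have "((\<lambda>t. integral unit_cube (\<lambda>y. w (T *v y + t *\<^sub>R axis i 1))) has_field_derivative
      integral unit_cube (\<lambda>y. w' (T *v y + 0 *\<^sub>R axis i 1))) (at 0 within UNIV)"
  proof (rule leibniz_rule_field_derivative)
    show "((\<lambda>t. w (T *v y + t *\<^sub>R axis i 1)) has_field_derivative w' (T *v y + t *\<^sub>R axis i 1)) (at t within UNIV)"
      for t y
      using DERIV_axis_shift[OF deriv] .
    show "(\<lambda>y. w (T *v y + t *\<^sub>R axis i 1)) integrable_on unit_cube" for t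
      by (intro integrable_continuous continuous_on_compose2[OF cont] continuous_intros) auto
    show "continuous_on (UNIV \<times> unit_cube) (\<lambda>(t, y). w' (T *v y + t *\<^sub>R axis i 1))"
      unfolding case_prod_unfold
      by (intro continuous_on_compose2[OF cont'] continuous_intros
          continuous_on_compose2[OF matrix_vector_mult_linear_continuous_on]) auto
  qed auto
  moreover have "integral unit_cube (\<lambda>y. w (T *v y + t *\<^sub>R axis i 1)) = torus_mean T w" for t
    using torus_mean_shift[OF assms(1) cont per, of "t *\<^sub>R axis i 1"] by (simp add: torus_mean_def)
  ultimately have "((\<lambda>t::real. torus_mean T w) has_field_derivative torus_mean T w') (at 0)"
    by (simp add: torus_mean_def)
  then show ?thesis
    using DERIV_unique DERIV_const by blast
qed

section \<open>Orthogonality of eigenspaces\<close>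

lemma torus_eigenspaceD:
  assumes "u \<in> torus_eigenspace T \<mu>"
  shows "C2_fun u" "torus_periodic T u" "laplacian u x = - (\<mu> * u x)"
proof -
  have "- laplacian u x = \<mu> * u x"
    using assms by (simp add: torus_eigenspace_def)
  then show "laplacian u x = - (\<mu> * u x)" by linarith
qed (use assms in \<open>auto simp: torus_eigenspace_def torus_periodic_def\<close>)

lemma torus_eigenspaceI:
  assumes "C2_fun u" "torus_periodic T u" "\<And>x. laplacian u x = - (\<mu> * u x)"
  shows "u \<in> torus_eigenspace T \<mu>"
  using assms by (auto simp: torus_eigenspace_def torus_periodic_def)

lemma subspace_torus_eigenspace: "fun_vs.subspace (torus_eigenspace T \<mu>)"
proof (rule fun_vs.subspaceI)
  show "0 \<in> torus_eigenspace T \<mu>"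
  proof (rule torus_eigenspaceI)
    have zero: "0 = plane_wave (0 :: real^'d) 0 0"
      by (simp add: plane_wave_def fun_eq_iff)
    show "C2_fun (0 :: real^'d \<Rightarrow> real)"
      unfolding zero by (rule C2_fun_plane_wave)
    show "laplacian (0 :: real^'d \<Rightarrow> real) x = - (\<mu> * 0 x)" for x
      using laplacian_plane_wave[of 0 0 0 x, folded zero] by simp
  qed (simp add: torus_periodic_def)
  show "u + v \<in> torus_eigenspace T \<mu>" if "u \<in> torus_eigenspace T \<mu>" "v \<in> torus_eigenspace T \<mu>" for u v
    using that[THEN torus_eigenspaceD(1)] that[THEN torus_eigenspaceD(2)] that[THEN torus_eigenspaceD(3)]
    by (intro torus_eigenspaceI) (auto simp: C2_fun_add laplacian_add torus_periodic_def algebra_simps)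
  show "(\<lambda>x. c * u x) \<in> torus_eigenspace T \<mu>" if "u \<in> torus_eigenspace T \<mu>" for c u
    using torus_eigenspaceD[OF that]
    by (intro torus_eigenspaceI) (auto simp: C2_fun_scale laplacian_scale torus_periodic_def algebra_simps)
qed

text \<open>The symmetry of the Laplacian: \<open>(\<Delta>u) v - u (\<Delta>v)\<close> is the divergence of
  \<open>(\<nabla>u) v - u (\<nabla>v)\<close> and therefore has mean zero.\<close>

lemma torus_eigenspaces_orthogonal:
  fixes T :: "real^'d^'d"
  assumes T: "invertible T" and u: "u \<in> torus_eigenspace T \<mu>" and v: "v \<in> torus_eigenspace T \<nu>"
    and neq: "\<mu> \<noteq> \<nu>"
  shows "torus_mean T (\<lambda>x. u x * v x) = 0"
proof -
  note uD = torus_eigenspaceD[OF u] and vD = torus_eigenspaceD[OF v]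
  let ?D = "\<lambda>i. partial_deriv i"
  have C1: "C1_fun u" "C1_fun v" "C1_fun (?D i u)" "C1_fun (?D i v)" for i
    using uD(1) vD(1) by (simp_all add: C2_fun_imp_C1)
  note cont = C1[THEN C1_fun_continuous]
  have cont2: "continuous_on UNIV (?D i (?D i u))" "continuous_on UNIV (?D i (?D i v))" for i
    using C1(3,4)[of i] by (auto simp: C1_fun_def)
  define w where "w i x = ?D i (?D i u) x * v x - u x * ?D i (?D i v) x" for i x
  have "torus_mean T (w i) = 0" for i
  proof (rule torus_mean_derivative_eq_0[OF T])
    show "torus_periodic T (\<lambda>x. ?D i u x * v x - u x * ?D i v x)"
      using uD(2) vD(2) torus_periodic_partial_deriv[of T u i] torus_periodic_partial_deriv[of T v i]
      by (auto simp: torus_periodic_def)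
    show "((\<lambda>t. ?D i u (x + t *\<^sub>R axis i 1) * v (x + t *\<^sub>R axis i 1)
        - u (x + t *\<^sub>R axis i 1) * ?D i v (x + t *\<^sub>R axis i 1)) has_field_derivative w i x) (at 0)" for x
      by (auto intro!: derivative_eq_intros C1_fun_DERIV C1 simp: w_def algebra_simps)
    show "continuous_on UNIV (\<lambda>x. ?D i u x * v x - u x * ?D i v x)"
      by (intro continuous_intros cont)
    show "continuous_on UNIV (w i)"
      unfolding w_def by (intro continuous_intros cont cont2)
  qed
  moreover have "continuous_on UNIV (w i)" for i
    unfolding w_def by (intro continuous_intros cont cont2)
  ultimately have "torus_mean T (\<lambda>x. \<Sum>i\<in>UNIV. w i x) = 0"
    by (simp add: torus_mean_sum)
  moreover have "(\<Sum>i\<in>UNIV. w i x) = (\<nu> - \<mu>) * (u x * v x)" for x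
  proof -
    have "(\<Sum>i\<in>UNIV. w i x) = laplacian u x * v x - u x * laplacian v x"
      by (simp add: w_def laplacian_def sum_subtractf sum_distrib_left sum_distrib_right)
    also have "\<dots> = (\<nu> - \<mu>) * (u x * v x)"
      by (simp add: uD(3) vD(3) algebra_simps)
    finally show ?thesis .
  qed
  ultimately show ?thesis
    using neq by (simp add: torus_mean_cmult)
qed

section \<open>The orthonormal system of lattice modes\<close>

text \<open>The plane waves whose frequency is \<open>2\<pi>\<close> times a dual lattice vector, indexed by the integer
  vector \<open>k\<close>.\<close>

definition torus_wave :: "real^'d^'d \<Rightarrow> real^'d \<Rightarrow> real \<Rightarrow> real \<Rightarrow> real^'d \<Rightarrow> real" where
  "torus_wave T k = plane_wave ((2 * pi) *\<^sub>R (dual_matrix T *v k))"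

text \<open>The Laplace eigenvalue \<open>4\<pi>\<^sup>2\<bar>T\<^bsup>-\<dagger>\<^esup>k\<bar>\<^sup>2\<close> of the waves with index \<open>k\<close>.\<close>

definition mode_eigenvalue :: "real^'d^'d \<Rightarrow> real^'d \<Rightarrow> real" where
  "mode_eigenvalue T k = (2 * pi)\<^sup>2 * (norm (dual_matrix T *v k))\<^sup>2"

text \<open>The real function \<open>cos + sin\<close> of the phase. Unlike the separate sines and cosines, these
  functions form an orthonormal system indexed by all integer vectors, without having to choose
  one vector from each pair \<open>{k, -k}\<close>.\<close>

definition torus_mode :: "real^'d^'d \<Rightarrow> real^'d \<Rightarrow> real^'d \<Rightarrow> real" where
  "torus_mode T k = torus_wave T k 1 1"

lemma continuous_on_torus_wave: "continuous_on S (torus_wave T k a b)"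
  by (simp add: torus_wave_def C1_fun_continuous C1_fun_plane_wave)

lemma torus_periodic_wave:
  fixes T :: "real^'d^'d"
  assumes T: "invertible T" and k: "k \<in> integer_vectors"
  shows "torus_periodic T (torus_wave T k a b)"
  unfolding torus_periodic_def lattice_of_eq
proof safe
  fix x m assume m: "m \<in> (integer_vectors :: (real^'d) set)"
  have "k \<bullet> m \<in> \<int>"
    using k m by (auto simp: inner_vec_def integer_vectors_def intro!: Ints_sum Ints_mult)
  moreover have "((2 * pi) *\<^sub>R (dual_matrix T *v k)) \<bullet> (x + T *v m)
      = ((2 * pi) *\<^sub>R (dual_matrix T *v k)) \<bullet> x + 2 * pi * (k \<bullet> m)"
    unfolding inner_scaleR_left dual_matrix_inner
    by (simp add: matrix_vector_right_distrib matrix_inv_vector[OF T] inner_add_right algebra_simps)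
  ultimately show "torus_wave T k a b (x + T *v m) = torus_wave T k a b x"
    by (simp add: torus_wave_def plane_wave_def cos_add sin_add cos_integer_2pi sin_integer_2pi
        del: inner_scaleR_left)
qed

lemma torus_wave_in_eigenspace:
  fixes T :: "real^'d^'d"
  assumes "invertible T" "k \<in> integer_vectors"
  shows "torus_wave T k a b \<in> torus_eigenspace T (mode_eigenvalue T k)"
proof (rule torus_eigenspaceI)
  show "torus_periodic T (torus_wave T k a b)"
    by (rule torus_periodic_wave[OF assms])
qed (simp_all add: torus_wave_def C2_fun_plane_wave laplacian_plane_wave mode_eigenvalue_def power_mult_distrib)

lemma torus_mean_wave:
  fixes T :: "real^'d^'d"
  assumes T: "invertible T" and k: "k \<in> integer_vectors"
  shows "torus_mean T (torus_wave T k a b) = (if k = 0 then a else 0)"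
proof (cases "k = 0")
  case True
  then show ?thesis
    using torus_mean_const[of T a] by (simp add: torus_wave_def plane_wave_def)
next
  case False
  let ?\<xi> = "(2 * pi) *\<^sub>R (dual_matrix T *v k)"
  have "?\<xi> \<noteq> 0"
    using False dual_matrix_eq_0_iff[OF T] by simp
  then obtain i where i: "?\<xi> $ i \<noteq> 0"
    by (metis vec_eq_iff zero_index)
  \<comment> \<open>The wave is itself a derivative of a wave, in a direction where the frequency is nonzero.\<close>
  define w where "w = torus_wave T k (- b / ?\<xi> $ i) (a / ?\<xi> $ i)"
  have w': "partial_deriv i w = torus_wave T k a b"
    using i unfolding w_def torus_wave_def partial_deriv_plane_wave by simp
  have C1: "C1_fun w"
    by (simp add: w_def torus_wave_def C1_fun_plane_wave)
  have per: "torus_periodic T w"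
    unfolding w_def by (rule torus_periodic_wave[OF T k])
  have cont: "continuous_on UNIV (partial_deriv i w)"
    unfolding w' by (rule continuous_on_torus_wave)
  have "torus_mean T (partial_deriv i w) = 0"
    by (rule torus_mean_derivative_eq_0[OF T per C1_fun_DERIV[OF C1] C1_fun_continuous[OF C1] cont])
  then show ?thesis using False w' by simp
qed

lemma torus_mode_product:
  "torus_mode T k x * torus_mode T l x = torus_wave T (k - l) 1 0 x + torus_wave T (k + l) 0 1 x"
  by (simp add: torus_mode_def torus_wave_def plane_wave_def matrix_vector_mult_diff_distrib
      matrix_vector_right_distrib inner_diff_left inner_add_left cos_diff sin_add algebra_simps
      scaleR_diff_right scaleR_add_right)

lemma torus_mode_orthonormal:
  fixes T :: "real^'d^'d"
  assumes "invertible T" "k \<in> integer_vectors" "l \<in> integer_vectors"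
  shows "torus_mean T (\<lambda>x. torus_mode T k x * torus_mode T l x) = (if k = l then 1 else 0)"
  unfolding torus_mode_product
  using assms by (simp add: torus_mean_add continuous_on_torus_wave torus_mean_wave integer_vectors_closed)

lemma continuous_on_torus_mode: "continuous_on S (torus_mode T k)"
  by (simp add: torus_mode_def continuous_on_torus_wave)

lemma inj_on_torus_mode:
  fixes T :: "real^'d^'d"
  assumes "invertible T"
  shows "inj_on (torus_mode T) integer_vectors"
proof (rule inj_onI)
  fix k l assume "k \<in> integer_vectors" "l \<in> integer_vectors" "torus_mode T k = torus_mode T l"
  then show "k = l"
    using torus_mode_orthonormal[OF assms, of k k] torus_mode_orthonormal[OF assms, of k l]
    by (auto split: if_splits)
qed

lemma torus_mean_mode_combination:
  fixes T :: "real^'d^'d"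
  assumes T: "invertible T" and K: "finite K" "K \<subseteq> integer_vectors" and l: "l \<in> integer_vectors"
  shows "torus_mean T (\<lambda>x. (\<Sum>k\<in>K. c k * torus_mode T k x) * torus_mode T l x) = (if l \<in> K then c l else 0)"
proof -
  have "torus_mean T (\<lambda>x. (\<Sum>k\<in>K. c k * torus_mode T k x) * torus_mode T l x)
      = torus_mean T (\<lambda>x. \<Sum>k\<in>K. c k * (torus_mode T k x * torus_mode T l x))"
    by (simp add: sum_distrib_right mult.assoc)
  also have "\<dots> = (\<Sum>k\<in>K. c k * torus_mean T (\<lambda>x. torus_mode T k x * torus_mode T l x))"
    by (subst torus_mean_sum) (auto simp: K torus_mean_cmult intro!: continuous_intros continuous_on_torus_mode)
  also have "\<dots> = (\<Sum>k\<in>K. if k = l then c k else 0)"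
    using K l by (intro sum.cong) (auto simp: torus_mode_orthonormal[OF T])
  finally show ?thesis using K(1) by simp
qed

lemma independent_torus_modes:
  fixes T :: "real^'d^'d"
  assumes T: "invertible T" and K: "K \<subseteq> integer_vectors"
  shows "fun_vs.independent (torus_mode T ` K)"
proof -
  have False if t: "finite t" "t \<subseteq> torus_mode T ` K" and zero: "(\<Sum>v\<in>t. (\<lambda>x. c v * v x)) = 0"
    and v: "v \<in> t" "c v \<noteq> 0" for t c v
  proof -
    obtain L where L: "L \<subseteq> K" "t = torus_mode T ` L"
      using t(2) by (meson subset_imageE)
    have inj: "inj_on (torus_mode T) L"
      using inj_on_torus_mode[OF T] L K by (meson inj_on_subset order_trans)
    have "finite L" using t(1) L(2) inj finite_imageD by blast
    obtain l where l: "l \<in> L" "v = torus_mode T l" using v L by blast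
    have "(\<Sum>k\<in>L. c (torus_mode T k) * torus_mode T k x) = 0" for x
      using fun_cong[OF zero, of x] by (simp add: L(2) sum.reindex[OF inj] sum_fun_apply)
    then have "c (torus_mode T l) = 0"
      using torus_mean_mode_combination[OF T \<open>finite L\<close>, of l "\<lambda>k. c (torus_mode T k)"] L K l
      by (auto simp: torus_mean_const)
    with v l show False by simp
  qed
  then show ?thesis
    unfolding fun_vs.dependent_explicit by blast
qed

section \<open>Completeness of the lattice modes\<close>

text \<open>Finite real linear combinations of the lattice modes. By \<open>torus_mode_product\<close> they form an
  algebra.\<close>

definition trig_polynomials :: "real^'d^'d \<Rightarrow> (real^'d \<Rightarrow> real) set" where
  "trig_polynomials T = fun_vs.span (torus_mode T ` integer_vectors)"

lemma trig_polynomials_subset: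
  assumes "fun_vs.subspace V" "\<And>k. k \<in> integer_vectors \<Longrightarrow> torus_mode T k \<in> V"
  shows "trig_polynomials T \<subseteq> V"
  unfolding trig_polynomials_def using assms by (intro fun_vs.span_minimal) auto

lemma torus_wave_trig_polynomial:
  assumes "k \<in> integer_vectors"
  shows "torus_wave T k a b \<in> trig_polynomials T"
proof -
  have neg: "dual_matrix T *v (- k) = - (dual_matrix T *v k)"
    using matrix_vector_mult_diff_distrib[of "dual_matrix T" 0 k] by simp
  have "torus_wave T k a b
      = (\<lambda>x. (a + b) / 2 * torus_mode T k x) + (\<lambda>x. (a - b) / 2 * torus_mode T (- k) x)"
    by (simp add: fun_eq_iff torus_mode_def torus_wave_def plane_wave_def neg field_simps)
  also have "\<dots> \<in> trig_polynomials T"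
    unfolding trig_polynomials_def
    by (intro fun_vs.span_add fun_vs.span_scale fun_vs.span_base imageI assms integer_vectors_closed)
  finally show ?thesis .
qed

lemma trig_polynomials_add:
  "f \<in> trig_polynomials T \<Longrightarrow> g \<in> trig_polynomials T \<Longrightarrow> (\<lambda>x. f x + g x) \<in> trig_polynomials T"
  unfolding trig_polynomials_def by (rule fun_vs.span_add[unfolded plus_fun_def])

lemma trig_polynomials_cmult:
  "f \<in> trig_polynomials T \<Longrightarrow> (\<lambda>x. c * f x) \<in> trig_polynomials T"
  unfolding trig_polynomials_def by (rule fun_vs.span_scale)

lemma trig_polynomials_const: "(\<lambda>_. c) \<in> trig_polynomials T"
  using torus_wave_trig_polynomial[OF integer_vectors_closed(1), of T c 0]
  by (simp add: torus_wave_def plane_wave_def)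

lemma trig_polynomials_mult:
  assumes f: "f \<in> trig_polynomials T" and g: "g \<in> trig_polynomials T"
  shows "(\<lambda>x. f x * g x) \<in> trig_polynomials T"
proof -
  have sub: "fun_vs.subspace {f. (\<lambda>x. f x * h x) \<in> trig_polynomials T}" for h
  proof (rule fun_vs.subspaceI; clarsimp)
    show "(\<lambda>x. 0) \<in> trig_polynomials T" by (rule trig_polynomials_const)
    show "(\<lambda>x. (u x + v x) * h x) \<in> trig_polynomials T"
      if "(\<lambda>x. u x * h x) \<in> trig_polynomials T" "(\<lambda>x. v x * h x) \<in> trig_polynomials T" for u v
      using trig_polynomials_add[OF that] by (simp add: distrib_right)
    show "(\<lambda>x. c * u x * h x) \<in> trig_polynomials T" if "(\<lambda>x. u x * h x) \<in> trig_polynomials T" for c u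
      using trig_polynomials_cmult[OF that, of c] by (simp add: mult.assoc)
  qed
  have "(\<lambda>x. torus_mode T k x * torus_mode T l x) \<in> trig_polynomials T"
    if "k \<in> integer_vectors" "l \<in> integer_vectors" for k l
    unfolding torus_mode_product
    using that by (intro trig_polynomials_add torus_wave_trig_polynomial integer_vectors_closed)
  then have "trig_polynomials T \<subseteq> {f. (\<lambda>x. f x * torus_mode T l x) \<in> trig_polynomials T}"
    if "l \<in> integer_vectors" for l
    using that by (intro trig_polynomials_subset sub) auto
  then have "(\<lambda>x. f x * torus_mode T l x) \<in> trig_polynomials T" if "l \<in> integer_vectors" for l
    using f that by blast
  then have "trig_polynomials T \<subseteq> {g. (\<lambda>x. g x * f x) \<in> trig_polynomials T}"
    by (intro trig_polynomials_subset sub) (simp add: mult.commute)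
  then show ?thesis using g by (auto simp: mult.commute)
qed

text \<open>An embedding of the torus as a product of circles. It turns functions on the torus into
  functions on a compact set, as the Stone--Weierstrass theorem requires.\<close>

definition torus_embedding :: "real^'d^'d \<Rightarrow> real^'d \<Rightarrow> complex^'d" where
  "torus_embedding T x = (\<chi> i. cis (2 * pi * (matrix_inv T *v x) $ i))"

lemma torus_wave_axis:
  "torus_wave T (axis i 1) a b x
    = a * Re (torus_embedding T x $ i) + b * Im (torus_embedding T x $ i)"
  unfolding torus_wave_def plane_wave_def torus_embedding_def inner_scaleR_left dual_matrix_inner
  by (simp add: inner_axis')

lemma continuous_on_torus_embedding: "continuous_on S (torus_embedding T)"
proof -
  have "continuous_on S (\<lambda>x. (matrix_inv T *v x) $ i)" for i
    by (intro continuous_on_component matrix_vector_mult_linear_continuous_on)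
  then show ?thesis
    unfolding torus_embedding_def by (intro continuous_intros)
qed

lemma torus_embedding_eq_iff:
  fixes T :: "real^'d^'d"
  assumes T: "invertible T"
  shows "torus_embedding T x = torus_embedding T y \<longleftrightarrow> (\<exists>k\<in>integer_vectors. y = x + T *v k)"
proof -
  have "torus_embedding T x = torus_embedding T y
      \<longleftrightarrow> (\<forall>i. \<exists>n::int. (matrix_inv T *v y) $ i = (matrix_inv T *v x) $ i + n)"
  proof -
    have "cis (2 * pi * a) = cis (2 * pi * b) \<longleftrightarrow> (\<exists>n::int. b = a + n)" for a b :: real
    proof -
      have "cis (2 * pi * a) = cis (2 * pi * b) \<longleftrightarrow> (\<exists>n::int. 2 * pi * b = 2 * pi * a + 2 * pi * n)"
        by (auto simp: complex_eq_iff simp flip: sin_cos_eq_iff)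
      also have "\<dots> \<longleftrightarrow> (\<exists>n::int. b = a + n)"
        by (simp flip: distrib_left)
      finally show ?thesis .
    qed
    then show ?thesis by (simp add: torus_embedding_def vec_eq_iff)
  qed
  also have "\<dots> \<longleftrightarrow> matrix_inv T *v y - matrix_inv T *v x \<in> integer_vectors"
  proof -
    have "(\<exists>n::int. b = a + n) \<longleftrightarrow> b - a \<in> \<int>" for a b :: real
    proof
      assume "b - a \<in> \<int>"
      then obtain n where "b - a = of_int n" by (rule Ints_cases)
      then have "b = a + of_int n" by simp
      then show "\<exists>n::int. b = a + n" ..
    qed auto
    then show ?thesis by (simp add: integer_vectors_def)
  qed
  also have "\<dots> \<longleftrightarrow> (\<exists>k\<in>integer_vectors. y = x + T *v k)"
  proof safe
    assume "matrix_inv T *v y - matrix_inv T *v x \<in> integer_vectors"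
    moreover have "y = x + T *v (matrix_inv T *v y - matrix_inv T *v x)"
      by (simp add: matrix_vector_mult_diff_distrib matrix_inv_vector[OF T])
    ultimately show "\<exists>k\<in>integer_vectors. y = x + T *v k" by blast
  qed (simp add: matrix_vector_right_distrib matrix_inv_vector[OF T])
  finally show ?thesis .
qed

lemma torus_fundamental_cell:
  fixes T :: "real^'d^'d"
  assumes T: "invertible T"
  obtains y k where "y \<in> unit_cube" "k \<in> integer_vectors" "x = T *v y + T *v k"
proof -
  define k where "k = (\<chi> i. real_of_int \<lfloor>(matrix_inv T *v x) $ i\<rfloor>)"
  define y where "y = matrix_inv T *v x - k"
  have "y \<in> unit_cube"
    by (auto simp: y_def k_def mem_box_cart) linarith
  moreover have "k \<in> integer_vectors"
    by (simp add: k_def integer_vectors_def)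
  moreover have "x = T *v y + T *v k"
    by (simp add: y_def matrix_vector_mult_diff_distrib matrix_inv_vector[OF T])
  ultimately show ?thesis using that by blast
qed

text \<open>The uniform density of the trigonometric polynomials: a continuous periodic function descends
  to a continuous function on the embedded torus, and the functions there that pull back to
  trigonometric polynomials form an algebra that contains the coordinates.\<close>

lemma trig_polynomials_dense:
  fixes T :: "real^'d^'d"
  assumes T: "invertible T" and cont: "continuous_on UNIV v" and per: "torus_periodic T v" and "e > 0"
  obtains f where "f \<in> trig_polynomials T" "\<And>x. \<bar>v x - f x\<bar> < e"
proof -
  define \<Phi> where "\<Phi> = torus_embedding T"
  define P where "P = (\<lambda>y. T *v y) ` unit_cube"
  have "compact P"
    unfolding P_def by (intro compact_continuous_image matrix_vector_mult_linear_continuous_on compact_cbox)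
  have cont_\<Phi>: "continuous_on S \<Phi>" for S
    unfolding \<Phi>_def by (rule continuous_on_torus_embedding)
  have range_\<Phi>: "range \<Phi> = \<Phi> ` P"
  proof safe
    fix x
    obtain y k where "y \<in> unit_cube" "k \<in> integer_vectors" "x = T *v y + T *v k"
      using torus_fundamental_cell[OF T] .
    moreover from this have "\<Phi> (T *v y) = \<Phi> x"
      unfolding \<Phi>_def torus_embedding_eq_iff[OF T] by blast
    ultimately show "\<Phi> x \<in> \<Phi> ` P"
      unfolding P_def by (metis image_eqI)
  qed (rule rangeI)
  have v_eq: "v x = v y" if "\<Phi> x = \<Phi> y" for x y
    using that torus_periodicD[OF per] unfolding \<Phi>_def torus_embedding_eq_iff[OF T] by metis
  define g where "g z = v (SOME x. \<Phi> x = z)" for z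
  have g: "g (\<Phi> x) = v x" for x
    unfolding g_def by (rule v_eq) (rule someI, rule refl)
  \<comment> \<open>The embedding restricted to the compact cell is a closed map, so it is a quotient map.\<close>
  have "continuous_on (range \<Phi>) g"
    unfolding continuous_closedin_preimage_eq
  proof (intro allI impI)
    fix C :: "real set" assume "closed C"
    then have "closed (v -` C)"
      using continuous_closed_vimage cont continuous_on_eq_continuous_at by blast
    then have "compact (P \<inter> v -` C)"
      using \<open>compact P\<close> by (rule compact_Int_closed[rotated])
    then have "compact (\<Phi> ` (P \<inter> v -` C))"
      by (rule compact_continuous_image[OF cont_\<Phi>])
    moreover have "range \<Phi> \<inter> g -` C = \<Phi> ` (P \<inter> v -` C)"
      unfolding range_\<Phi> using g by auto
    ultimately show "closedin (top_of_set (range \<Phi>)) (range \<Phi> \<inter> g -` C)"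
      by (metis closed_subset compact_imp_closed inf_le1)
  qed
  define R where "R = {h. continuous_on (range \<Phi>) h \<and> (\<lambda>x. h (\<Phi> x)) \<in> trig_polynomials T}"
  have R_D: "continuous_on (range \<Phi>) h" "(\<lambda>x. h (\<Phi> x)) \<in> trig_polynomials T" if "h \<in> R" for h
    using that unfolding R_def by auto
  interpret function_ring_on R "range \<Phi>"
  proof
    show "compact (range \<Phi>)"
      unfolding range_\<Phi> by (rule compact_continuous_image[OF cont_\<Phi> \<open>compact P\<close>])
    show "\<exists>h\<in>R. h z \<noteq> h w" if "z \<noteq> w" for z w
    proof -
      obtain i where "z $ i \<noteq> w $ i" using \<open>z \<noteq> w\<close> by (auto simp: vec_eq_iff)
      then have "Re (z $ i) \<noteq> Re (w $ i) \<or> Im (z $ i) \<noteq> Im (w $ i)"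
        by (simp add: complex_eq_iff)
      have "(\<lambda>z. a * Re (z $ i) + b * Im (z $ i)) \<in> R" for a b
        unfolding R_def mem_Collect_eq \<Phi>_def torus_wave_axis[symmetric]
        by (auto intro!: continuous_intros torus_wave_trig_polynomial integer_vectors_closed)
      from this[of 1 0] this[of 0 1] have "(\<lambda>z. Re (z $ i)) \<in> R" "(\<lambda>z. Im (z $ i)) \<in> R"
        by simp_all
      then show ?thesis
        using bexI[of "\<lambda>h. h z \<noteq> h w" "\<lambda>z. Re (z $ i)" R] bexI[of "\<lambda>h. h z \<noteq> h w" "\<lambda>z. Im (z $ i)" R]
          \<open>Re (z $ i) \<noteq> Re (w $ i) \<or> Im (z $ i) \<noteq> Im (w $ i)\<close> by argo
    qed
    fix h h' assume "h \<in> R" "h' \<in> R"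
    note hh' = R_D[OF this(1)] R_D[OF this(2)]
    show "(\<lambda>z. h z + h' z) \<in> R" "(\<lambda>z. h z * h' z) \<in> R"
      unfolding R_def mem_Collect_eq
      by (intro conjI continuous_on_add continuous_on_mult trig_polynomials_add trig_polynomials_mult hh')+
  next
    show "continuous_on (range \<Phi>) h" if "h \<in> R" for h
      using that by (rule R_D)
    show "(\<lambda>_. c) \<in> R" for c
      by (simp add: R_def trig_polynomials_const)
  qed
  obtain h where h: "h \<in> R" "\<forall>z\<in>range \<Phi>. \<bar>g z - h z\<bar> < e"
    using Stone_Weierstrass_basic[OF \<open>continuous_on (range \<Phi>) g\<close> \<open>e > 0\<close>] by (rule bexE)
  show ?thesis
  proof (rule that)
    show "(\<lambda>x. h (\<Phi> x)) \<in> trig_polynomials T"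
      using \<open>h \<in> R\<close> by (simp add: R_def)
    show "\<bar>v x - h (\<Phi> x)\<bar> < e" for x
      using bspec[OF h(2) rangeI, of x] by (simp add: g)
  qed
qed

lemma torus_modes_complete:
  fixes T :: "real^'d^'d"
  assumes T: "invertible T" and cont: "continuous_on UNIV v" and per: "torus_periodic T v"
    and orth: "\<And>k. k \<in> integer_vectors \<Longrightarrow> torus_mean T (\<lambda>x. v x * torus_mode T k x) = 0"
  shows "v = 0"
proof -
  have scale: "torus_mean T (\<lambda>x. v x * (c * f x)) = c * torus_mean T (\<lambda>x. v x * f x)" for c f
    using torus_mean_cmult[of T c "\<lambda>x. v x * f x"] by (simp add: mult.left_commute)
  have add: "torus_mean T (\<lambda>x. v x * (f x + g x)) = torus_mean T (\<lambda>x. v x * f x) + torus_mean T (\<lambda>x. v x * g x)"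
    if "continuous_on UNIV f" "continuous_on UNIV g" for f g
    unfolding distrib_left by (intro torus_mean_add continuous_intros cont that)
  have "trig_polynomials T \<subseteq> {f. continuous_on UNIV f \<and> torus_mean T (\<lambda>x. v x * f x) = 0}"
  proof (rule trig_polynomials_subset)
    show "fun_vs.subspace {f. continuous_on UNIV f \<and> torus_mean T (\<lambda>x. v x * f x) = 0}"
      unfolding fun_vs.subspace_def using cont
      by (auto simp: plus_fun_def zero_fun_def add torus_mean_const scale
          intro!: continuous_intros)
  qed (auto simp: orth continuous_on_torus_mode)
  then have poly: "continuous_on UNIV f" "torus_mean T (\<lambda>x. v x * f x) = 0" if "f \<in> trig_polynomials T" for f
    using that by auto
  \<comment> \<open>From \<open>v\<^sup>2 \<le> (v - f)\<^sup>2 + 2 v f\<close>, where \<open>v f\<close> has mean zero.\<close>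
  have small: "torus_mean T (\<lambda>x. v x * v x) \<le> e" if "e > 0" for e
  proof -
    obtain f where f: "f \<in> trig_polynomials T" "\<And>x. \<bar>v x - f x\<bar> < sqrt e"
      using trig_polynomials_dense[OF T cont per, of "sqrt e"] \<open>e > 0\<close> real_sqrt_gt_zero by metis
    note cf = poly(1)[OF f(1)]
    have "torus_mean T (\<lambda>x. v x * v x) \<le> torus_mean T (\<lambda>x. e + 2 * (v x * f x))"
      unfolding torus_mean_def
    proof (intro integral_le torus_integrable continuous_intros cont cf)
      fix y
      have "(v (T *v y) - f (T *v y))\<^sup>2 \<le> (sqrt e)\<^sup>2"
        using f(2)[of "T *v y"] \<open>e > 0\<close> by (intro power2_le_iff_abs_le[THEN iffD2]) auto
      moreover have "(v (T *v y) - f (T *v y))\<^sup>2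
          = v (T *v y) * v (T *v y) - 2 * (v (T *v y) * f (T *v y)) + (f (T *v y))\<^sup>2"
        by (simp add: power2_eq_square algebra_simps)
      moreover have "(sqrt e)\<^sup>2 = e" using \<open>e > 0\<close> by simp
      ultimately show "v (T *v y) * v (T *v y) \<le> e + 2 * (v (T *v y) * f (T *v y))"
        using zero_le_power2[of "f (T *v y)"] by linarith
    qed
    also have "\<dots> = e"
      using poly(2)[OF f(1)]
      by (subst torus_mean_add) (auto intro!: continuous_intros cont cf simp: torus_mean_const torus_mean_cmult)
    finally show ?thesis .
  qed
  have cont2: "continuous_on unit_cube (\<lambda>y. v (T *v y) * v (T *v y))"
    by (intro continuous_intros continuous_on_torus_coordinates cont)
  have "torus_mean T (\<lambda>x. v x * v x) \<ge> 0"
    unfolding torus_mean_def by (intro integral_nonneg integrable_continuous cont2) simp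
  moreover have "torus_mean T (\<lambda>x. v x * v x) \<le> 0"
    using small field_le_epsilon[of _ "0::real"] by auto
  ultimately have "integral unit_cube (\<lambda>y. v (T *v y) * v (T *v y)) = 0"
    by (simp add: torus_mean_def)
  moreover have "box 0 (1::real^'d) \<noteq> {}"
    by (simp add: interval_ne_empty_cart)
  ultimately have zero: "v (T *v y) = 0" if "y \<in> unit_cube" for y
    using integral_cbox_eq_0_iff[OF cont2] that by simp
  show ?thesis
  proof
    fix x
    obtain y k where "y \<in> unit_cube" "k \<in> integer_vectors" "x = T *v y + T *v k"
      using torus_fundamental_cell[OF T] .
    then show "v x = 0 x"
      using torus_periodicD[OF per] zero by simp
  qed
qed

section \<open>The spectrum of a flat torus\<close>

lemma finite_bounded_integer_vectors:
  "finite {k \<in> (integer_vectors :: (real^'d) set). norm k \<le> C}"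
proof -
  let ?S = "{a::real. a \<in> \<int> \<and> \<bar>a\<bar> \<le> C}"
  have "{k \<in> (integer_vectors :: (real^'d) set). norm k \<le> C} \<subseteq> vec_lambda ` (UNIV \<rightarrow>\<^sub>E ?S)"
  proof
    fix k :: "real^'d" assume "k \<in> {k \<in> integer_vectors. norm k \<le> C}"
    then have "vec_nth k \<in> UNIV \<rightarrow>\<^sub>E ?S"
      using component_le_norm_cart[of k] by (auto simp: integer_vectors_def intro: order_trans)
    then have "vec_lambda (vec_nth k) \<in> vec_lambda ` (UNIV \<rightarrow>\<^sub>E ?S)"
      by (rule imageI)
    then show "k \<in> vec_lambda ` (UNIV \<rightarrow>\<^sub>E ?S)" by simp
  qed
  moreover have "finite (vec_lambda ` ((UNIV :: 'd set) \<rightarrow>\<^sub>E ?S))"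
    by (intro finite_imageI finite_PiE finite_abs_int_segment) simp
  ultimately show ?thesis by (rule finite_subset)
qed

lemma infinite_integer_vectors: "infinite (integer_vectors :: (real^'d) set)"
proof
  assume "finite (integer_vectors :: (real^'d) set)"
  moreover have "range (\<lambda>n::nat. of_nat n *\<^sub>R (1 :: real^'d)) \<subseteq> integer_vectors"
    by (auto simp: integer_vectors_def)
  moreover have "inj (\<lambda>n::nat. of_nat n *\<^sub>R (1 :: real^'d))"
    by (rule injI) simp
  ultimately show False
    by (meson finite_subset infinite_UNIV_nat finite_imageD)
qed

lemma finite_mode_eigenvalue_le:
  fixes T :: "real^'d^'d"
  assumes T: "invertible T"
  shows "finite {k \<in> integer_vectors. mode_eigenvalue T k \<le> M}"
proof -
  obtain B where B: "B > 0" "\<And>y. norm (transpose T *v y) \<le> norm y * B"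
    using bounded_linear.pos_bounded[OF matrix_vector_mul_bounded_linear[of "transpose T"]] by blast
  have norm_le: "norm k \<le> norm (dual_matrix T *v k) * B" for k
  proof -
    have "transpose T *v (dual_matrix T *v k) = k"
    proof (rule vector_eq_rdot[THEN iffD1, rule_format])
      fix z
      have "(transpose T *v (dual_matrix T *v k)) \<bullet> z = (dual_matrix T *v k) \<bullet> (T *v z)"
        by (simp add: dot_lmul_matrix)
      then show "(transpose T *v (dual_matrix T *v k)) \<bullet> z = k \<bullet> z"
        by (simp add: dual_matrix_inner matrix_inv_vector[OF T])
    qed
    then show ?thesis using B(2)[of "dual_matrix T *v k"] by simp
  qed
  have "norm k \<le> sqrt (M / (2 * pi)\<^sup>2) * B" if "mode_eigenvalue T k \<le> M" for k
  proof -
    have "(norm (dual_matrix T *v k))\<^sup>2 \<le> M / (2 * pi)\<^sup>2"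
      using that by (simp add: mode_eigenvalue_def field_simps)
    then have "norm (dual_matrix T *v k) \<le> sqrt (M / (2 * pi)\<^sup>2)"
      by (rule real_le_rsqrt)
    then show ?thesis
      using norm_le[of k] B(1) by (meson mult_right_mono less_imp_le order_trans)
  qed
  then have "{k \<in> integer_vectors. mode_eigenvalue T k \<le> M}
      \<subseteq> {k \<in> integer_vectors. norm k \<le> sqrt (M / (2 * pi)\<^sup>2) * B}"
    by blast
  then show ?thesis
    by (rule finite_subset) (rule finite_bounded_integer_vectors)
qed

lemma finite_mode_eigenvalue_eq:
  fixes T :: "real^'d^'d"
  assumes "invertible T"
  shows "finite {k \<in> integer_vectors. mode_eigenvalue T k = \<mu>}"
  by (rule finite_subset[OF _ finite_mode_eigenvalue_le[OF assms, of \<mu>]]) auto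

text \<open>An eigenfunction minus its finite projection onto the modes with the same eigenvalue is
  orthogonal to all modes: to the others by the orthogonality of eigenspaces. By completeness it
  vanishes.\<close>

lemma torus_eigenspace_eq_span:
  fixes T :: "real^'d^'d"
  assumes T: "invertible T"
  shows "torus_eigenspace T \<mu>
    = fun_vs.span (torus_mode T ` {k \<in> integer_vectors. mode_eigenvalue T k = \<mu>})"
    (is "_ = fun_vs.span (_ ` ?K)")
proof
  have mode: "torus_mode T k \<in> torus_eigenspace T (mode_eigenvalue T k)" if "k \<in> integer_vectors" for k
    unfolding torus_mode_def by (rule torus_wave_in_eigenspace[OF T that])
  show span: "fun_vs.span (torus_mode T ` ?K) \<subseteq> torus_eigenspace T \<mu>"
    using mode by (intro fun_vs.span_minimal subspace_torus_eigenspace) auto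
  show "torus_eigenspace T \<mu> \<subseteq> fun_vs.span (torus_mode T ` ?K)"
  proof
    fix u assume u: "u \<in> torus_eigenspace T \<mu>"
    have K: "finite ?K" "?K \<subseteq> integer_vectors"
      using finite_mode_eigenvalue_eq[OF T] by auto
    define c where "c k = torus_mean T (\<lambda>x. u x * torus_mode T k x)" for k
    define p where "p = (\<Sum>k\<in>?K. (\<lambda>x. c k * torus_mode T k x))"
    have p: "p x = (\<Sum>k\<in>?K. c k * torus_mode T k x)" for x
      by (simp add: p_def sum_fun_apply)
    have p_span: "p \<in> fun_vs.span (torus_mode T ` ?K)"
      unfolding p_def by (intro fun_vs.span_sum fun_vs.span_scale fun_vs.span_base imageI)
    have cont: "continuous_on UNIV f" "torus_periodic T f" if "f \<in> torus_eigenspace T \<mu>" for f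
      using torus_eigenspaceD[OF that] by (simp_all add: C2_fun_imp_C1 C1_fun_continuous)
    have p_space: "p \<in> torus_eigenspace T \<mu>" using span p_span by blast
    have "(\<lambda>x. u x - p x) = 0"
    proof (rule torus_modes_complete[OF T])
      show "continuous_on UNIV (\<lambda>x. u x - p x)"
        by (intro continuous_intros cont u p_space)
      show "torus_periodic T (\<lambda>x. u x - p x)"
        using cont(2)[OF u] cont(2)[OF p_space] by (simp add: torus_periodic_def)
      fix l :: "real^'d" assume l: "l \<in> integer_vectors"
      have "torus_mean T (\<lambda>x. (u x - p x) * torus_mode T l x)
          = c l - torus_mean T (\<lambda>x. p x * torus_mode T l x)"
        unfolding c_def left_diff_distrib
        by (intro torus_mean_diff continuous_intros cont u p_space continuous_on_torus_mode)
      also have "\<dots> = c l - (if l \<in> ?K then c l else 0)"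
        unfolding p torus_mean_mode_combination[OF T K l] ..
      also have "\<dots> = 0"
        using torus_eigenspaces_orthogonal[OF T u mode[OF l]] l by (auto simp: c_def)
      finally show "torus_mean T (\<lambda>x. (u x - p x) * torus_mode T l x) = 0" .
    qed
    then have "u = p"
      by (simp add: fun_eq_iff)
    with p_span show "u \<in> fun_vs.span (torus_mode T ` ?K)" by simp
  qed
qed

text \<open>As all bases of an eigenspace have the same size, the multiplicity of an eigenvalue is the
  number of integer vectors that yield it.\<close>

lemma torus_eigenvalue_sequence_iff:
  fixes T :: "real^'d^'d"
  assumes T: "invertible T"
  shows "torus_eigenvalue_sequence T \<tau> \<longleftrightarrow> mono_on {1..} \<tau> \<and>
    (\<forall>\<mu>. finite {j \<in> {1..}. \<tau> j = \<mu>} \<and>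
      card {j \<in> {1..}. \<tau> j = \<mu>} = card {k \<in> integer_vectors. mode_eigenvalue T k = \<mu>})"
proof -
  have "(\<exists>B. finite B \<and> fun_vs.independent B \<and> fun_vs.span B = torus_eigenspace T \<mu> \<and> card B = n)
      \<longleftrightarrow> n = card {k \<in> integer_vectors. mode_eigenvalue T k = \<mu>}" for \<mu> n
  proof -
    let ?K = "{k \<in> integer_vectors. mode_eigenvalue T k = \<mu>}"
    let ?B = "torus_mode T ` ?K"
    have B: "finite ?B" "fun_vs.independent ?B" "fun_vs.span ?B = torus_eigenspace T \<mu>"
      using finite_mode_eigenvalue_eq[OF T] independent_torus_modes[OF T] torus_eigenspace_eq_span[OF T]
      by auto
    have card: "card ?B = card ?K"
      by (intro card_image inj_on_subset[OF inj_on_torus_mode[OF T]]) auto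
    show ?thesis
    proof
      have dim: "card B' = fun_vs.dim (fun_vs.span B')" if "fun_vs.independent B'" for B' :: "(real^'d \<Rightarrow> real) set"
        using that by (simp add: fun_vs.dim_span fun_vs.dim_eq_card_independent)
      assume "\<exists>B. finite B \<and> fun_vs.independent B \<and> fun_vs.span B = torus_eigenspace T \<mu> \<and> card B = n"
      then obtain B' where "fun_vs.independent B'" "fun_vs.span B' = torus_eigenspace T \<mu>" "card B' = n"
        by blast
      then show "n = card ?K"
        using dim[of B'] dim[OF B(2)] B(3) card by simp
    next
      assume "n = card ?K"
      then show "\<exists>B. finite B \<and> fun_vs.independent B \<and> fun_vs.span B = torus_eigenspace T \<mu> \<and> card B = n"
        using B card by (intro exI[of _ ?B]) simp
    qed
  qed
  then show ?thesis
    unfolding torus_eigenvalue_sequence_def by simp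
qed

lemma torus_eigenvalue_sequence_torus_eigenvalue:
  fixes T :: "real^'d^'d"
  assumes T: "invertible T"
  shows "torus_eigenvalue_sequence T (torus_eigenvalue T)"
  unfolding torus_eigenvalue_def
proof (rule someI_ex[of "torus_eigenvalue_sequence T"])
  let ?Z = "integer_vectors :: (real^'d) set"
  obtain e :: "nat \<Rightarrow> real^'d" where e: "bij_betw e UNIV ?Z" and mono: "mono (\<lambda>n. mode_eigenvalue T (e n))"
    using monotone_enumeration_exists[OF infinite_integer_vectors finite_mode_eigenvalue_le[OF T]] by blast
  define \<tau> where "\<tau> j = mode_eigenvalue T (e (j - 1))" for j
  have "mono_on {1..} \<tau>"
    by (rule mono_onI) (simp add: \<tau>_def monoD[OF mono] diff_le_mono)
  moreover have bij: "bij_betw (\<lambda>j. e (j - 1)) {j \<in> {1..}. \<tau> j = \<mu>} {k \<in> ?Z. mode_eigenvalue T k = \<mu>}" for \<mu>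
  proof -
    have "bij_betw (\<lambda>j::nat. j - 1) {1..} UNIV"
      by (rule bij_betw_byWitness[where f' = Suc]) auto
    from bij_betw_trans[OF this e] have "bij_betw (\<lambda>j. e (j - 1)) {1..} ?Z"
      by (simp add: comp_def)
    then show ?thesis
      unfolding \<tau>_def by (auto simp: bij_betw_def inj_on_def)
  qed
  then have "finite {j \<in> {1..}. \<tau> j = \<mu>}" for \<mu>
    using bij_betw_finite[OF bij] finite_mode_eigenvalue_eq[OF T] by simp
  ultimately show "\<exists>\<tau>. torus_eigenvalue_sequence T \<tau>"
    unfolding torus_eigenvalue_sequence_iff[OF T]
    by (intro exI[of _ \<tau>] conjI allI bij_betw_same_card[OF bij])
qed

text \<open>The eigenvalues with multiplicity are the mode eigenvalues, in the order of some bijective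
  enumeration of the integer vectors, which has to begin with the zero vector.\<close>

lemma torus_eigenvalue_enumeration:
  fixes T :: "real^'d^'d"
  assumes T: "invertible T"
  obtains e :: "nat \<Rightarrow> real^'d"
  where "bij_betw e {1..} integer_vectors" "e 1 = 0"
    "\<And>j. 1 \<le> j \<Longrightarrow> torus_eigenvalue T j = mode_eigenvalue T (e j)"
proof -
  let ?\<tau> = "torus_eigenvalue T"
  have \<tau>: "mono_on {1..} ?\<tau>" "\<And>\<mu>. finite {j \<in> {1..}. ?\<tau> j = \<mu>}"
    "\<And>\<mu>. card {j \<in> {1..}. ?\<tau> j = \<mu>} = card {k \<in> integer_vectors. mode_eigenvalue T k = \<mu>}"
    using torus_eigenvalue_sequence_torus_eigenvalue[OF T] unfolding torus_eigenvalue_sequence_iff[OF T] by blast+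
  obtain e :: "nat \<Rightarrow> real^'d" where e: "bij_betw e {1..} integer_vectors"
    "\<forall>j\<in>{1..}. mode_eigenvalue T (e j) = ?\<tau> j"
    using fibrewise_bijection_exists[OF \<tau>(2) finite_mode_eigenvalue_eq[OF T] \<tau>(3)] by blast
  obtain i where i: "i \<in> {1..}" "e i = 0"
    using bij_betw_imp_surj_on[OF e(1)] integer_vectors_closed(1) by (metis imageE)
  have "mode_eigenvalue T (e 1) = ?\<tau> 1" using e(2) by simp
  also have "\<dots> \<le> ?\<tau> i" using i by (intro mono_onD[OF \<tau>(1)]) auto
  also have "\<dots> = mode_eigenvalue T 0" using e(2) i by metis
  finally have "(norm (dual_matrix T *v e 1))\<^sup>2 \<le> 0"
    by (simp add: mode_eigenvalue_def mult_le_0_iff)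
  then have "e 1 = 0"
    by (simp add: dual_matrix_eq_0_iff[OF T])
  show ?thesis
    by (rule that[OF e(1) \<open>e 1 = 0\<close>]) (use e(2) in simp)
qed

text \<open>The variational bound: the modes of any \<open>n - 1\<close> distinct nonzero integer vectors have total
  eigenvalue at least \<open>\<tau>\<^sub>2 + \<dots> + \<tau>\<^sub>n\<close>.\<close>

lemma torus_eigenvalue_sum_le:
  fixes T :: "real^'d^'d"
  assumes T: "invertible T"
    and K: "finite K" "K \<subseteq> integer_vectors" "0 \<notin> K" "card K = card {2..n}"
  shows "(\<Sum>j=2..n. torus_eigenvalue T j) \<le> (\<Sum>k\<in>K. mode_eigenvalue T k)"
proof -
  obtain e :: "nat \<Rightarrow> real^'d" where e: "bij_betw e {1..} integer_vectors" "e 1 = 0"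
    "\<And>j. 1 \<le> j \<Longrightarrow> torus_eigenvalue T j = mode_eigenvalue T (e j)"
    using torus_eigenvalue_enumeration[OF T] by blast
  define J where "J = {j \<in> {1..}. e j \<in> K}"
  have inj: "inj_on e J"
    using bij_betw_imp_inj_on[OF e(1)] by (rule inj_on_subset) (auto simp: J_def)
  have image: "e ` J = K"
    using bij_betw_imp_surj_on[OF e(1)] K(2) by (auto simp: J_def)
  have "finite J" "card J = card K"
    using inj image K(1) by (auto simp: card_image dest: finite_imageD)
  moreover have "J \<subseteq> {2..}"
  proof
    fix j assume "j \<in> J"
    then have "j \<ge> 1" "j \<noteq> 1" using e(2) K(3) by (auto simp: J_def)
    then show "j \<in> {2..}" by simp
  qed
  moreover have "mono_on {1..} (torus_eigenvalue T)"
    using torus_eigenvalue_sequence_torus_eigenvalue[OF T] by (simp add: torus_eigenvalue_sequence_def)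
  ultimately have "(\<Sum>j=2..n. torus_eigenvalue T j) \<le> (\<Sum>j\<in>J. torus_eigenvalue T j)"
    using K(4) by (intro sum_initial_segment_le) auto
  also have "\<dots> = (\<Sum>j\<in>J. mode_eigenvalue T (e j))"
    by (intro sum.cong) (auto simp: J_def e(3))
  also have "\<dots> = (\<Sum>k\<in>K. mode_eigenvalue T k)"
    using inj image by (metis sum.reindex comp_apply sum.cong)
  finally show ?thesis .
qed

section \<open>Comparison with the cubical torus\<close>

lemma norm_orthogonal_matrix_vector:
  fixes Q :: "real^'d^'d"
  assumes "orthogonal_matrix Q"
  shows "norm (Q *v x) = norm x"
proof -
  have "transpose Q *v (Q *v x) = x"
    using assms unfolding orthogonal_matrix_def by (metis matrix_vector_mul_assoc matrix_vector_mul_lid)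
  then have "(Q *v x) \<bullet> (Q *v x) = x \<bullet> x"
    by (metis dot_lmul_matrix transpose_matrix_vector)
  then show ?thesis by (simp add: norm_eq)
qed

lemma dual_matrix_scaled_orthogonal:
  fixes Q :: "real^'d^'d"
  assumes Q: "orthogonal_matrix Q" and "c \<noteq> 0"
  shows "dual_matrix (c *\<^sub>R Q) = (1 / c) *\<^sub>R Q"
proof -
  have inv: "(c *\<^sub>R Q) ** ((1 / c) *\<^sub>R transpose Q) = mat 1" "((1 / c) *\<^sub>R transpose Q) ** (c *\<^sub>R Q) = mat 1"
    using assms
    by (simp_all add: orthogonal_matrix_def matrix_scalar_ac scalar_matrix_assoc[symmetric])
  then have invertible: "invertible (c *\<^sub>R Q)"
    unfolding invertible_def by blast
  have "matrix_inv (c *\<^sub>R Q) *v x = ((1 / c) *\<^sub>R transpose Q) *v x" for x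
    using inv matrix_inv_vector[OF invertible] by (metis matrix_vector_mul_assoc matrix_vector_mul_lid)
  then have "matrix_inv (c *\<^sub>R Q) = (1 / c) *\<^sub>R transpose Q"
    by (simp add: matrix_eq)
  then show ?thesis
    by (simp add: dual_matrix_def transpose_def vec_eq_iff)
qed

lemma hs_norm_orthogonal:
  fixes Q :: "real^'d^'d"
  assumes "orthogonal_matrix Q"
  shows "(hs_norm Q)\<^sup>2 = real CARD('d)"
proof -
  have "(hs_norm Q)\<^sup>2 = (\<Sum>j\<in>UNIV. (norm (row j Q))\<^sup>2)"
    unfolding power2_norm_eq_inner by (simp add: hs_norm_def sum_nonneg row_def inner_vec_def power2_eq_square)
  also have "\<dots> = real CARD('d)"
    using assms by (simp add: orthogonal_matrix_orthonormal_rows)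
  finally show ?thesis .
qed

lemma hs_norm_scaleR: "(hs_norm (a *\<^sub>R M))\<^sup>2 = a\<^sup>2 * (hs_norm M)\<^sup>2"
  by (simp add: hs_norm_def sum_nonneg power_mult_distrib sum_distrib_left)

theorem proposition3p6:
  fixes S T Q :: "real^'d^'d" and c :: real and n :: nat
  assumes "CARD('d) \<ge> 2" and "n \<ge> 2"
    and "orthogonal_matrix Q" and "S = c *\<^sub>R Q" and "invertible S"
    and "invertible T"
  shows "normalized_eigenvalue_sum T n \<le> normalized_eigenvalue_sum S n"
proof -
  let ?d = "real CARD('d)"
  have "c \<noteq> 0"
  proof
    assume "c = 0"
    then have "S *v axis undefined 1 = 0" by (simp add: assms(4))
    then show False
      using matrix_inv_vector(2)[OF assms(5), of "axis undefined 1"] by (simp add: axis_eq_0_iff)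
  qed
  have dual_S: "dual_matrix S = (1 / c) *\<^sub>R Q"
    using dual_matrix_scaled_orthogonal[OF assms(3) \<open>c \<noteq> 0\<close>] assms(4) by simp
  have hs_S: "(hs_norm (dual_matrix S))\<^sup>2 = ?d / c\<^sup>2"
    by (simp add: dual_S hs_norm_scaleR hs_norm_orthogonal[OF assms(3)] power_divide)
  have mode_S: "mode_eigenvalue S k = (2 * pi)\<^sup>2 * (norm k)\<^sup>2 / c\<^sup>2" for k
  proof -
    have "norm (Q *v k) = norm k"
      by (rule norm_orthogonal_matrix_vector[OF assms(3)])
    then show ?thesis
      by (simp add: mode_eigenvalue_def dual_S scaleR_matrix_vector_assoc[symmetric] power_divide)
  qed
  obtain e where e: "bij_betw e {1..} (integer_vectors :: (real^'d) set)" "e 1 = 0"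
    "\<And>j. 1 \<le> j \<Longrightarrow> torus_eigenvalue S j = mode_eigenvalue S (e j)"
    using torus_eigenvalue_enumeration[OF assms(5)] by blast
  let ?E = "\<Sum>j=2..n. (norm (e j))\<^sup>2"
  let ?G = "signed_permutations :: (('d \<Rightarrow> 'd) \<times> ('d \<Rightarrow> real)) set"
  let ?N = "real (card ?G)"
  let ?t = "\<Sum>j=2..n. torus_eigenvalue T j"
  \<comment> \<open>The signed permutations move the integer vectors that are optimal for the cubical torus to
    admissible trial vectors for \<open>T\<close>.\<close>
  have t_le: "?t \<le> (\<Sum>j=2..n. mode_eigenvalue T (signed_permutation g (e j)))" if g: "g \<in> ?G" for g
  proof -
    let ?f = "\<lambda>j. signed_permutation g (e j)"
    have inj_e: "inj_on e {1..}" using e(1) by (rule bij_betw_imp_inj_on)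
    have inj: "inj_on ?f {1..}"
      using comp_inj_on[OF inj_e inj_on_subset[OF inj_signed_permutation[OF g]]] by (simp add: comp_def)
    have f1: "?f 1 = 0" using e(2) by (simp add: signed_permutation_def vec_eq_iff)
    have "?t \<le> (\<Sum>k\<in>?f ` {2..n}. mode_eigenvalue T k)"
    proof (rule torus_eigenvalue_sum_le[OF assms(6)])
      show "?f ` {2..n} \<subseteq> integer_vectors"
      proof (rule image_subsetI)
        fix j assume "j \<in> {2..n}"
        then have "e j \<in> integer_vectors" using bij_betwE[OF e(1)] by simp
        then show "?f j \<in> integer_vectors" by (rule signed_permutation_integer[OF g])
      qed
      show "0 \<notin> ?f ` {2..n}"
      proof
        assume "0 \<in> ?f ` {2..n}"
        then obtain j where j: "j \<in> {2..n}" "?f j = ?f 1" using f1 by auto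
        then have "j = 1" by (intro inj_onD[OF inj, of j 1]) auto
        with j show False by simp
      qed
      show "card (?f ` {2..n}) = card {2..n}"
        by (intro card_image inj_on_subset[OF inj]) auto
    qed simp
    also have "\<dots> = (\<Sum>j=2..n. mode_eigenvalue T (?f j))"
      by (subst sum.reindex) (auto intro: inj_on_subset[OF inj])
    finally show ?thesis .
  qed
  have "?N * ?t \<le> (\<Sum>g\<in>?G. \<Sum>j=2..n. mode_eigenvalue T (signed_permutation g (e j)))"
    using sum_bounded_below[of ?G ?t, OF t_le] by simp
  also have "\<dots> = (\<Sum>j=2..n. \<Sum>g\<in>?G. mode_eigenvalue T (signed_permutation g (e j)))"
    by (rule sum.swap)
  also have "\<dots> = (\<Sum>j=2..n. ?N * ((2 * pi)\<^sup>2 * (hs_norm (dual_matrix T))\<^sup>2 / ?d * (norm (e j))\<^sup>2))"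
  proof (rule sum.cong[OF refl])
    fix j
    have "(\<Sum>g\<in>?G. (norm (dual_matrix T *v signed_permutation g (e j)))\<^sup>2)
        = ?N * ((hs_norm (dual_matrix T))\<^sup>2 * (norm (e j))\<^sup>2) / ?d"
      using sum_signed_permutations_norm[of "dual_matrix T" "e j"] by (simp add: field_simps)
    then show "(\<Sum>g\<in>?G. mode_eigenvalue T (signed_permutation g (e j)))
        = ?N * ((2 * pi)\<^sup>2 * (hs_norm (dual_matrix T))\<^sup>2 / ?d * (norm (e j))\<^sup>2)"
      by (simp add: mode_eigenvalue_def flip: sum_distrib_left)
  qed
  also have "\<dots> = ?N * ((2 * pi)\<^sup>2 * (hs_norm (dual_matrix T))\<^sup>2 / ?d * ?E)"
    by (simp add: sum_distrib_left)
  finally have t_bound: "?t \<le> (2 * pi)\<^sup>2 * (hs_norm (dual_matrix T))\<^sup>2 / ?d * ?E"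
    using finite_signed_permutations signed_permutations_nonempty
    by (metis card_gt_0_iff mult_le_cancel_left_pos of_nat_0_less_iff)
  have "normalized_eigenvalue_sum T n \<le> (2 * pi)\<^sup>2 / ?d * ?E"
  \<comment> \<open>The degenerate case cannot occur, but it is harmless because \<open>1 / 0 = 0\<close>.\<close>
  proof (cases "hs_norm (dual_matrix T) = 0")
    case True
    then show ?thesis
      by (simp add: normalized_eigenvalue_sum_def dual_matrix_def sum_nonneg)
  next
    case False
    then have "?t * (1 / (hs_norm (dual_matrix T))\<^sup>2)
        \<le> ((2 * pi)\<^sup>2 * (hs_norm (dual_matrix T))\<^sup>2 / ?d * ?E) * (1 / (hs_norm (dual_matrix T))\<^sup>2)"
      using t_bound by (intro mult_right_mono) auto
    then show ?thesis
      using False by (simp add: normalized_eigenvalue_sum_def flip: dual_matrix_def)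
  qed
  also have "\<dots> = normalized_eigenvalue_sum S n"
  proof -
    have "(\<Sum>j=2..n. torus_eigenvalue S j) = (2 * pi)\<^sup>2 * ?E / c\<^sup>2"
      by (simp add: e(3) mode_S sum_distrib_left sum_divide_distrib)
    then show ?thesis
      using \<open>c \<noteq> 0\<close> by (simp add: normalized_eigenvalue_sum_def hs_S flip: dual_matrix_def)
  qed
  finally show ?thesis .
qed

end
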